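(* Let $t_1,\dots,t_d\ge2$ be integers and let $T=\mathrm{diag}(t_1,\dots,t_d)$. Let $\psi:\mathbb{R}^+\to\mathbb{R}^+$ be a real positive function such that $\psi(x)<2^{-d}$ and let $\mathbf{a}=(a_1,\dots,a_d)\in\mathbb{T}^d$. Then, for any $\varepsilon>0$, $$\#\Big\{1\le n\le N:\prod_{1\le i\le d}\|t_i^nx_i-a_i\|\le\psi(n)\Big\}=\Phi(N)+O\left(\Phi^{1/2}(N)\,(\log\Phi(N))^{3/2+\varepsilon}\right)$$ for $m_d$-almost all $\mathbf{x}=(x_1,\dots,x_d)\in\mathbb{T}^d$, where $$\Phi(N)=\sum_{n=1}^N2^d\psi(n)\left(\sum_{s=0}^{d-1}\frac1{s!}\left(\log\frac1{2^d\psi(n)}\right)^s\right).$$ In particular, $$m_d\big(W^\times(T,\psi,\mathbf{a})\big)=\begin{cases}0&\text{if }\sum_{n=1}^\infty\psi(n)\big(\log\frac1{\psi(n)}\big)^{d-1}<\infty,\\ 1&\text{if }\sum_{n=1}^\infty\psi(n)\big(\log\frac1{\psi(n)}\big)^{d-1}=\infty.\end{cases}$$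
   Context: $\mathbb{T}^d=\mathbb{R}^d/\mathbb{Z}^d$, $m_d$ is $d$-dimensional Lebesgue measure and $\|\cdot\|$ is the distance to the nearest integer. Here $$W^\times(T,\psi,\mathbf{a})=\Big\{\mathbf{x}\in[0,1)^d:\prod_{1\le i\le d}\|t_i^nx_i-a_i\|\le\psi(n)\text{ for infinitely many }n\in\mathbb{N}\Big\}.$$ Convention: the implied constant in $O(\cdot)$ may depend on $\mathbf{x}$ and $\varepsilon$ but not on $N$; in the error term $\log\Phi(N)$ is read as $\max\{1,\log\Phi(N)\}$. *)

theory Defs
  imports "HOL-Analysis.Analysis" "HOL-Library.Landau_Symbols"
begin

definition dist_int :: "real \<Rightarrow> real" where
  "dist_int x = infdist x \<int>"

text \<open>
  The torus is represented by its fundamental domain; all quantities below depend on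
  \<open>a\<close> and, for integer \<open>t\<close>, on \<open>x\<close> only modulo 1 in each coordinate.
\<close>
definition torus :: "(real ^ 'd) set" where
  "torus = {x. \<forall>i. 0 \<le> x $ i \<and> x $ i < 1}"

definition diag_mat :: "('d \<Rightarrow> int) \<Rightarrow> int ^ 'd ^ 'd" where
  "diag_mat t = (\<chi> i j. if i = j then t i else 0)"

text \<open>The matrix \<open>T\<close> is meant to be diagonal, so that only its diagonal entries are used.\<close>
definition W_times ::
  "int ^ 'd ^ 'd \<Rightarrow> (real \<Rightarrow> real) \<Rightarrow> real ^ 'd::finite \<Rightarrow> (real ^ 'd) set" where
  "W_times T \<psi> a =
     {x \<in> torus. infinite {n::nat. 1 \<le> n \<and>
        (\<Prod>i\<in>UNIV. dist_int (of_int (T $ i $ i) ^ n * x $ i - a $ i)) \<le> \<psi> (real n)}}"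

definition Phi :: "nat \<Rightarrow> (real \<Rightarrow> real) \<Rightarrow> nat \<Rightarrow> real" where
  "Phi d \<psi> N = (\<Sum>n=1..N. 2 ^ d * \<psi> (real n) *
     (\<Sum>s<d. 1 / fact s * ln (1 / (2 ^ d * \<psi> (real n))) ^ s))"

end

theory Submission
  imports Defs "HOL-Probability.Probability" "HOL-Real_Asymp.Real_Asymp"
begin

text \<open>
  Let \<open>E\<^sub>n\<close> be the event that \<open>\<Prod>\<^sub>i \<parallel>t\<^sub>i\<^sup>n x\<^sub>i - a\<^sub>i\<parallel> \<le> \<psi>(n)\<close>. Multiplication by \<open>t\<^sub>i\<close> preserves Lebesgue measure
  modulo 1, so the measure of \<open>E\<^sub>n\<close> is the volume of a hyperbolic region, which is the \<open>n\<close>-th term of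
  \<open>\<Phi>\<close>. Lines parallel to the axes meet this region in arcs, and an arc correlates with a
  \<open>1/K\<close>-periodic set only up to \<open>O(1/K)\<close> times the measure of that set; replacing the coordinates one
  at a time gives \<open>m(E\<^sub>j \<inter> E\<^sub>k) \<le> (m(E\<^sub>j) + 6d 2\<^bsup>-(k-j)\<^esup>) m(E\<^sub>k)\<close> for \<open>j < k\<close>. Hence the variance of the
  number of hits in a block is bounded by a multiple of its mean. Cutting the time axis into blocks of
  mean about 1 and summing the variances of all dyadic unions of blocks (Rademacher--Menshov)
  yields the almost sure error term, and with Borel--Cantelli the zero-one law.
\<close>

section \<open>Distance to the nearest integer\<close>

text \<open>In general the hyperbolic region is neither convex nor a product of arcs, but its slices
  parallel to an axis are simple: each is empty, the whole circle or one arc modulo 1, with a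
  bounded number of endpoints whatever the other coordinates are. The resulting correlation error is
  proportional to the measure of the later event E_k. For fixed k the errors sum over j < k to a
  geometric series, so the variance of a block is controlled by its mean and not by its length.

  This is also why blocks are cut by mean. About Phi(N) blocks lie below N, so the logarithms that
  the dyadic argument costs are logarithms of Phi(N) and not of N. The exponent 3/2 + eps is half of
  3 + 2 eps: with r about log Phi(N), one factor r comes from Cauchy-Schwarz along the binary
  digits, one from the r scales whose variances are added, and r^(1 + 2 eps) from asking for a
  convergent series over r. If Phi is bounded, there are not enough unit blocks; there
  Borel-Cantelli bounds the count, and a constant error is admissible.\<close>

lemma dist_int_eq_round: "dist_int x = \<bar>x - of_int (round x)\<bar>"
proof (rule antisym)
  show "dist_int x \<le> \<bar>x - of_int (round x)\<bar>"
    unfolding dist_int_def using infdist_le[of "of_int (round x)" "\<int>" x] by (simp add: dist_real_def)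
next
  obtain y where y: "y \<in> \<int>" "infdist x \<int> = dist x y"
    using infdist_attains_inf[of "\<int>::real set" x] Ints_0 closed_Ints by blast
  then obtain k where "y = of_int k" by (auto elim: Ints_cases)
  then show "\<bar>x - of_int (round x)\<bar> \<le> dist_int x"
    unfolding dist_int_def using y round_diff_minimal[of x k] by (simp add: dist_real_def)
qed

lemma dist_int_nonneg: "0 \<le> dist_int x"
  by (simp add: dist_int_eq_round)

lemma dist_int_le_half: "dist_int x \<le> 1 / 2"
  using of_int_round_abs_le[of x] by (simp add: dist_int_eq_round abs_minus_commute)

lemma dist_int_le_abs_diff: "dist_int x \<le> \<bar>x - of_int k\<bar>"
  using round_diff_minimal[of x k] by (simp add: dist_int_eq_round)

lemma dist_int_add_of_int [simp]: "dist_int (x + of_int k) = dist_int x"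
proof -
  have "dist_int (x + of_int k) \<le> dist_int x" for x k
    using dist_int_le_abs_diff[of "x + of_int k" "round x + k"] by (simp add: dist_int_eq_round)
  from this[of x k] this[of "x + of_int k" "-k"] show ?thesis by simp
qed

lemma dist_int_eq_abs: "\<bar>x\<bar> \<le> 1 / 2 \<Longrightarrow> dist_int x = \<bar>x\<bar>"
proof (rule antisym)
  assume x: "\<bar>x\<bar> \<le> 1 / 2"
  show "dist_int x \<le> \<bar>x\<bar>" using dist_int_le_abs_diff[of x 0] by simp
  show "\<bar>x\<bar> \<le> dist_int x"
  proof (cases "round x = 0")
    case False
    then have "1 \<le> \<bar>real_of_int (round x)\<bar>"
      by linarith
    then show ?thesis using x by (simp add: dist_int_eq_round)
  qed (simp add: dist_int_eq_round)
qed

lemma borel_measurable_dist_int [measurable]: "dist_int \<in> borel_measurable borel"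
  unfolding dist_int_def by (intro borel_measurable_continuous_onI continuous_intros)

text \<open>An integer multiple of the integer part is again an integer. Hence an orbit may be
  reduced to [0,1) before a further expansion without changing any distance.\<close>

lemma dist_int_mult_frac: "dist_int (of_int k * frac x - b) = dist_int (of_int k * x - b)"
proof -
  have "of_int k * x - b = of_int k * frac x - b + of_int (k * \<lfloor>x\<rfloor>)"
    by (simp add: frac_def algebra_simps)
  then show ?thesis by (metis dist_int_add_of_int)
qed

lemma borel_measurable_frac [measurable]: "(frac :: real \<Rightarrow> real) \<in> borel_measurable borel"
  unfolding frac_def[abs_def] by measurable

section \<open>One-dimensional mixing\<close>

text \<open>Carried by [0,1) but defined on the whole line, so that periodic functions and affine
  substitutions need no restricted space.\<close>

definition unif :: "real measure" where
  "unif = uniform_measure lborel {0..<1}"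

lemma sets_unif [measurable_cong, simp]: "sets unif = sets borel"
  by (simp add: unif_def)

lemma space_unif [simp]: "space unif = UNIV"
  by (simp add: unif_def)

lemma prob_space_unif: "prob_space unif"
  unfolding unif_def by (rule prob_space_uniform_measure) auto

interpretation unif: prob_space unif by (rule prob_space_unif)

lemma emeasure_unif: "A \<in> sets borel \<Longrightarrow> emeasure unif A = emeasure lborel ({0..<1} \<inter> A)"
  by (simp add: unif_def divide_ennreal_def)

lemma nn_integral_unif:
  "f \<in> borel_measurable borel \<Longrightarrow> (\<integral>\<^sup>+x. f x \<partial>unif) = (\<integral>\<^sup>+x. f x * indicator {0..<1} x \<partial>lborel)"
  by (simp add: unif_def nn_integral_uniform_measure divide_ennreal_def)

text \<open>The window is moved by an integer so that it starts at c in [0,1); its part beyond 1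
  then shifts back to [0,c). The circle can thus be cut open wherever an arc is easiest to
  measure.\<close>

lemma nn_integral_periodic_window:
  fixes f :: "real \<Rightarrow> ennreal"
  assumes [measurable]: "f \<in> borel_measurable borel" and per: "\<And>x k. f (x + of_int k) = f x"
  shows "(\<integral>\<^sup>+x. f x * indicator {b..<b + 1} x \<partial>lborel) = (\<integral>\<^sup>+x. f x \<partial>unif)"
proof -
  define c where "c = frac b"
  have c: "0 \<le> c" "c < 1" by (auto simp: c_def frac_lt_1)
  have shift: "(\<integral>\<^sup>+x. f x * indicator {l + of_int k..<u + of_int k} x \<partial>lborel) =
      (\<integral>\<^sup>+x. f x * indicator {l..<u} x \<partial>lborel)" for l u k
    by (subst nn_integral_real_affine[where c = 1 and t = "of_int k"])
       (auto simp: per add.commute[of "real_of_int k"] intro!: nn_integral_cong split: split_indicator)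
  have "(\<integral>\<^sup>+x. f x * indicator {b..<b + 1} x \<partial>lborel) = (\<integral>\<^sup>+x. f x * indicator {c..<c + 1} x \<partial>lborel)"
    using shift[of c "\<lfloor>b\<rfloor>" "c + 1"] by (simp add: c_def frac_def algebra_simps)
  also have "\<dots> = (\<integral>\<^sup>+x. (f x * indicator {c..<1} x + f x * indicator {1..<c + 1} x) \<partial>lborel)"
    using c by (intro nn_integral_cong) (auto split: split_indicator)
  also have "\<dots> = (\<integral>\<^sup>+x. f x * indicator {c..<1} x \<partial>lborel) + (\<integral>\<^sup>+x. f x * indicator {1..<c + 1} x \<partial>lborel)"
    by (rule nn_integral_add) auto
  also have "(\<integral>\<^sup>+x. f x * indicator {1..<c + 1} x \<partial>lborel) = (\<integral>\<^sup>+x. f x * indicator {0..<c} x \<partial>lborel)"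
    using shift[of 0 1 c] by simp
  also have "(\<integral>\<^sup>+x. f x * indicator {c..<1} x \<partial>lborel) + (\<integral>\<^sup>+x. f x * indicator {0..<c} x \<partial>lborel) =
      (\<integral>\<^sup>+x. (f x * indicator {c..<1} x + f x * indicator {0..<c} x) \<partial>lborel)"
    by (rule nn_integral_add[symmetric]) auto
  also have "\<dots> = (\<integral>\<^sup>+x. f x * indicator {0..<1} x \<partial>lborel)"
    using c by (intro nn_integral_cong) (auto split: split_indicator)
  finally show ?thesis by (simp add: nn_integral_unif)
qed

text \<open>The arc is open and punctured because this is the exact shape of the event
  \<open>-ln (2 * dist_int (x - a)) > b\<close>, with r = exp (-b) / 2, under the convention ln 0 =
  0.\<close>

lemma emeasure_unif_dist_int:
  assumes "0 \<le> r" "r \<le> 1 / 2"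
  shows "emeasure unif {x. 0 < dist_int (x - a) \<and> dist_int (x - a) < r} = ennreal (2 * r)"
proof -
  let ?S = "{y. 0 < dist_int y \<and> dist_int y < r}"
  have [measurable]: "?S \<in> sets borel" by measurable
  have [simp]: "indicator ?S (x + of_int k) = (indicator ?S x :: ennreal)" for x k
    by (auto split: split_indicator)
  have "emeasure unif {x. 0 < dist_int (x - a) \<and> dist_int (x - a) < r} =
      (\<integral>\<^sup>+x. indicator ?S (x - a) \<partial>unif)"
  proof -
    have "(\<integral>\<^sup>+x. indicator ?S (x - a) \<partial>unif) =
        (\<integral>\<^sup>+x. indicator {x. 0 < dist_int (x - a) \<and> dist_int (x - a) < r} x \<partial>unif)"
      by (intro nn_integral_cong) (auto split: split_indicator)
    also have "\<dots> = emeasure unif {x. 0 < dist_int (x - a) \<and> dist_int (x - a) < r}"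
      by (rule nn_integral_indicator) measurable
    finally show ?thesis ..
  qed
  \<comment> \<open>Cutting the circle opposite to a keeps the arc in one window, on which the
    distance is |x - a|.\<close>
  also have "\<dots> = (\<integral>\<^sup>+x. indicator ?S (x - a) * indicator {a - 1 / 2..<a - 1 / 2 + 1} x \<partial>lborel)"
    by (rule nn_integral_periodic_window[symmetric])
       (auto simp: diff_add_eq[symmetric] simp del: indicator_simps)
  also have "\<dots> = (\<integral>\<^sup>+x. indicator ?S x * indicator {-1 / 2..<1 / 2} x \<partial>lborel)"
    by (subst nn_integral_real_affine[where c = 1 and t = a])
       (auto intro!: nn_integral_cong split: split_indicator)
  also have "\<dots> = (\<integral>\<^sup>+x. indicator ({-r<..<0} \<union> {0<..<r}) x \<partial>lborel)"
    using assms by (intro nn_integral_cong) (auto simp: dist_int_eq_abs split: split_indicator)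
  also have "\<dots> = emeasure lborel {-r<..<0} + emeasure lborel {0<..<r}"
    by (subst nn_integral_indicator, simp, subst plus_emeasure) auto
  also have "\<dots> = ennreal (2 * r)"
    using assms by (simp flip: ennreal_plus)
  finally show ?thesis .
qed

text \<open>For r = 1/2 the preceding punctured arc already has full measure, which leaves nothing
  for its centre.\<close>

lemma emeasure_unif_dist_int_0: "emeasure unif {x. dist_int (x - a) = 0} = 0"
proof -
  have "emeasure unif (UNIV - {x. dist_int (x - a) = 0}) = 1"
  proof (rule antisym)
    have "emeasure unif {x. 0 < dist_int (x - a) \<and> dist_int (x - a) < 1 / 2} \<le>
        emeasure unif (UNIV - {x. dist_int (x - a) = 0})"
      by (rule emeasure_mono) (auto, measurable)
    then show "1 \<le> emeasure unif (UNIV - {x. dist_int (x - a) = 0})"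
      by (subst (asm) emeasure_unif_dist_int) auto
  qed (rule unif.emeasure_le_1)
  then have "unif.prob (UNIV - {x. dist_int (x - a) = 0}) = 1"
    by (simp add: unif.emeasure_eq_measure)
  then have "unif.prob {x. dist_int (x - a) = 0} = 0"
    using unif.prob_compl[of "{x. dist_int (x - a) = 0}"] by simp
  then show ?thesis by (simp add: unif.emeasure_eq_measure)
qed

text \<open>The substitution y = K x - q maps the cell affinely onto [0,1), where y is the
  fractional part of K x; its Jacobian is the factor 1/K.\<close>

lemma nn_integral_unif_cell:
  fixes h :: "real \<Rightarrow> ennreal" and K q :: int
  assumes [measurable]: "h \<in> borel_measurable borel" and K: "K \<ge> 1"
  shows "(\<integral>\<^sup>+x. h (frac (of_int K * x)) * indicator {x. \<lfloor>of_int K * x\<rfloor> = q} x \<partial>lborel) =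
    ennreal (1 / of_int K) * (\<integral>\<^sup>+x. h x \<partial>unif)"
proof -
  have eq: "h (-of_int q + of_int K * x) * indicator {0..<1} (-of_int q + of_int K * x) =
      h (frac (of_int K * x)) * indicator {x. \<lfloor>of_int K * x\<rfloor> = q} x" for x
  proof (cases "\<lfloor>of_int K * x\<rfloor> = q")
    case True
    then have "-of_int q + of_int K * x = frac (of_int K * x)" by (simp add: frac_def)
    then show ?thesis using True by (simp add: frac_lt_1)
  next
    case False
    then show ?thesis by (auto simp: floor_eq_iff split: split_indicator)
  qed
  have "(\<integral>\<^sup>+x. h x \<partial>unif) = ennreal (of_int K) *
      (\<integral>\<^sup>+x. h (frac (of_int K * x)) * indicator {x. \<lfloor>of_int K * x\<rfloor> = q} x \<partial>lborel)"
    unfolding eq[symmetric] nn_integral_unif[OF assms(1)] using K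
    by (subst nn_integral_real_affine[where c = "of_int K" and t = "-of_int q"]) auto
  then show ?thesis
    using K by (simp add: mult.assoc[symmetric] flip: ennreal_mult)
qed

lemma nn_integral_unif_frac_mult:
  fixes h :: "real \<Rightarrow> ennreal" and K :: int
  assumes [measurable]: "h \<in> borel_measurable borel" and K: "K \<ge> 1"
  shows "(\<integral>\<^sup>+x. h (frac (of_int K * x)) \<partial>unif) = (\<integral>\<^sup>+x. h x \<partial>unif)"
proof -
  have hK: "(\<lambda>x. h (frac (of_int K * x))) \<in> borel_measurable borel" by measurable
  have "(\<integral>\<^sup>+x. h (frac (of_int K * x)) \<partial>unif) =
      (\<integral>\<^sup>+x. (\<Sum>q\<in>{0..<K}. h (frac (of_int K * x)) * indicator {x. \<lfloor>of_int K * x\<rfloor> = q} x) \<partial>lborel)"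
    unfolding nn_integral_unif[OF hK]
  proof (intro nn_integral_cong)
    fix x :: real
    have "x \<in> {0..<1} \<longleftrightarrow> \<lfloor>of_int K * x\<rfloor> \<in> {0..<K}"
      using K by (simp add: le_floor_iff floor_less_iff mult_less_cancel_left2 zero_le_mult_iff)
    then show "h (frac (of_int K * x)) * indicator {0..<1} x =
        (\<Sum>q\<in>{0..<K}. h (frac (of_int K * x)) * indicator {x. \<lfloor>of_int K * x\<rfloor> = q} x)"
      by (auto simp: indicator_def sum_distrib_left[symmetric])
  qed
  also have "\<dots> = (\<Sum>q\<in>{0..<K}. ennreal (1 / of_int K) * (\<integral>\<^sup>+x. h x \<partial>unif))"
    by (subst nn_integral_sum) (auto simp: nn_integral_unif_cell[OF assms])
  also have "\<dots> = (\<integral>\<^sup>+x. h x \<partial>unif)"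
    using K by (simp add: mult.assoc[symmetric] ennreal_of_nat_eq_real_of_nat flip: ennreal_mult)
  finally show ?thesis .
qed

text \<open>
  Of the \<open>K\<close> cells \<open>[q/K, (q+1)/K)\<close>, those inside the arc have total length at most that of the arc,
  and each cell meeting the arc without lying inside it contains one of the six endpoints
  \<open>a + k \<plusminus> r\<close>, \<open>k \<in> {-1, 0, 1}\<close>.
\<close>
lemma nn_integral_arc_frac_mult_le:
  fixes h :: "real \<Rightarrow> ennreal" and K :: int
  assumes [measurable]: "h \<in> borel_measurable borel" and K: "K \<ge> 1" and a: "0 \<le> a" "a < 1"
  shows "(\<integral>\<^sup>+x. indicator {x. dist_int (x - a) \<le> r} x * h (frac (of_int K * x)) \<partial>unif) \<le>
    (emeasure unif {x. dist_int (x - a) \<le> r} + ennreal (6 / of_int K)) * (\<integral>\<^sup>+x. h x \<partial>unif)"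
proof -
  define C where "C = {x. dist_int (x - a) \<le> r}"
  define cell where "cell q = {x :: real. \<lfloor>of_int K * x\<rfloor> = q}" for q
  have [measurable]: "C \<in> sets borel" "cell q \<in> sets borel" for q
    by (simp_all add: C_def cell_def)
  have hC: "(\<lambda>x. indicator C x * h (frac (of_int K * x))) \<in> borel_measurable borel" by measurable
  have K0: "0 < real_of_int K" using K by simp
  have unit: "x \<in> {0..<1} \<longleftrightarrow> \<lfloor>of_int K * x\<rfloor> \<in> {0..<K}" for x :: real
    using K by (simp add: le_floor_iff floor_less_iff mult_less_cancel_left2 zero_le_mult_iff)
  define G1 where "G1 = {q \<in> {0..<K}. cell q \<subseteq> C}"
  define G2 where "G2 = {q \<in> {0..<K}. \<not> cell q \<subseteq> C \<and> cell q \<inter> C \<noteq> {}}"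
  define ends where "ends = (\<lambda>(k, s). a + of_int k + s * r) ` ({-1, 0, 1} \<times> {-1, 1})"
  have "finite G1" "finite G2" by (auto simp: G1_def G2_def intro: finite_subset[of _ "{0..<K}"])
  have int_cell: "(\<integral>\<^sup>+x. g (frac (of_int K * x)) * indicator (cell q) x \<partial>lborel) =
      ennreal (1 / of_int K) * (\<integral>\<^sup>+x. g x \<partial>unif)" if "g \<in> borel_measurable borel" for g q
    unfolding cell_def by (rule nn_integral_unif_cell[OF that K])
  have "G2 \<subseteq> (\<lambda>e. \<lfloor>of_int K * e\<rfloor>) ` ends"
  proof
    fix q assume "q \<in> G2"
    then obtain x y where q: "q \<in> {0..<K}" and x: "x \<in> cell q" "x \<in> C" and y: "y \<in> cell q" "y \<notin> C"
      by (auto simp: G2_def)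
    \<comment> \<open>The arc lifts to intervals around a + k; this k picks the one that contains x.
      Only three lifts matter since x and a both lie in [0,1).\<close>
    define k where "k = round (x - a)"
    have kx: "\<bar>x - a - of_int k\<bar> \<le> r" "\<bar>x - a - of_int k\<bar> \<le> 1 / 2"
      using x(2) dist_int_le_half[of "x - a"] by (simp_all add: C_def dist_int_eq_round k_def)
    have "0 \<le> x" "x < 1" using q x(1) unit[of x] by (simp_all add: cell_def)
    then have "real_of_int k < 2" "-2 < real_of_int k"
      using kx(2) a by linarith+
    then have k: "k \<in> {-1, 0, 1}" by auto
    have ky: "\<not> \<bar>y - a - of_int k\<bar> \<le> r"
      using y(2) dist_int_le_abs_diff[of "y - a" k] by (simp add: C_def)
    have "\<exists>s\<in>{-1, 1}. (x \<le> a + of_int k + s * r \<and> a + of_int k + s * r \<le> y) \<or>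
        (y \<le> a + of_int k + s * r \<and> a + of_int k + s * r \<le> x)"
      using kx(1) ky by auto
    then obtain s where s: "s \<in> {-1, 1}" and
      btw: "(x \<le> a + of_int k + s * r \<and> a + of_int k + s * r \<le> y) \<or>
        (y \<le> a + of_int k + s * r \<and> a + of_int k + s * r \<le> x)" by blast
    define e where "e = a + of_int k + s * r"
    have "\<lfloor>of_int K * e\<rfloor> = q"
    proof -
      have xq: "of_int q \<le> of_int K * x" "of_int K * x < of_int q + 1"
        and yq: "of_int q \<le> of_int K * y" "of_int K * y < of_int q + 1"
        using x(1) y(1) by (auto simp: cell_def floor_eq_iff)
      have "(of_int K * x \<le> of_int K * e \<and> of_int K * e \<le> of_int K * y) \<or>
          (of_int K * y \<le> of_int K * e \<and> of_int K * e \<le> of_int K * x)"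
        using btw K0 unfolding e_def[symmetric] by (simp only: mult_le_cancel_left_pos)
      then show ?thesis using xq yq by (auto simp: floor_eq_iff)
    qed
    moreover have "e \<in> ends" using s k unfolding ends_def e_def by force
    ultimately show "q \<in> (\<lambda>e. \<lfloor>of_int K * e\<rfloor>) ` ends" by blast
  qed
  moreover have "finite ends" by (simp add: ends_def)
  moreover have "card ends \<le> 6"
    using card_image_le[of "{-1, 0, 1 :: int} \<times> {-1, 1 :: real}" "\<lambda>(k, s). a + of_int k + s * r"]
    by (simp add: ends_def card_cartesian_product)
  ultimately have card_G2: "card G2 \<le> 6"
    by (meson card_image_le card_mono finite_imageI order_trans)
  have "ennreal (real (card G1) / of_int K) = (\<Sum>q\<in>G1. \<integral>\<^sup>+x. indicator (cell q) x \<partial>lborel)"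
    using int_cell[of "\<lambda>_. 1"] K0
    by (simp add: unif.emeasure_space_1[simplified] ennreal_of_nat_eq_real_of_nat del: nn_integral_indicator flip: ennreal_mult)
  also have "\<dots> = (\<integral>\<^sup>+x. (\<Sum>q\<in>G1. indicator (cell q) x) \<partial>lborel)"
    by (rule nn_integral_sum[symmetric]) auto
  also have "\<dots> \<le> (\<integral>\<^sup>+x. indicator C x * indicator {0..<1} x \<partial>lborel)"
  proof (intro nn_integral_mono)
    fix x
    have "(\<Sum>q\<in>G1. indicator (cell q) x :: ennreal) = (if \<lfloor>of_int K * x\<rfloor> \<in> G1 then 1 else 0)"
      using \<open>finite G1\<close> by (simp add: indicator_def cell_def)
    also have "\<dots> \<le> indicator C x * indicator {0..<1} x"
      using unit[of x] by (auto simp: G1_def cell_def split: split_indicator)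
    finally show "(\<Sum>q\<in>G1. indicator (cell q) x :: ennreal) \<le> indicator C x * indicator {0..<1} x" .
  qed
  also have "\<dots> = emeasure unif C"
    by (subst nn_integral_unif[symmetric]) auto
  finally have G1: "ennreal (real (card G1) / of_int K) \<le> emeasure unif C" .
  have "(\<integral>\<^sup>+x. indicator C x * h (frac (of_int K * x)) \<partial>unif) \<le>
      (\<integral>\<^sup>+x. (\<Sum>q\<in>G1 \<union> G2. h (frac (of_int K * x)) * indicator (cell q) x) \<partial>lborel)"
    unfolding nn_integral_unif[OF hC]
  proof (intro nn_integral_mono)
    fix x :: real
    have "x \<in> C \<Longrightarrow> x \<in> {0..<1} \<Longrightarrow> \<lfloor>of_int K * x\<rfloor> \<in> G1 \<union> G2"
      using unit[of x] by (auto simp: G1_def G2_def cell_def)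
    then show "indicator C x * h (frac (of_int K * x)) * indicator {0..<1} x \<le>
        (\<Sum>q\<in>G1 \<union> G2. h (frac (of_int K * x)) * indicator (cell q) x)"
      using \<open>finite G1\<close> \<open>finite G2\<close>
      by (auto simp: indicator_def sum_distrib_left[symmetric] cell_def)
  qed
  also have "\<dots> = (\<Sum>q\<in>G1 \<union> G2. ennreal (1 / of_int K) * (\<integral>\<^sup>+x. h x \<partial>unif))"
    by (subst nn_integral_sum) (auto simp: int_cell)
  also have "\<dots> = ennreal (real (card (G1 \<union> G2)) / of_int K) * (\<integral>\<^sup>+x. h x \<partial>unif)"
    using K0 by (simp add: mult.assoc[symmetric] ennreal_of_nat_eq_real_of_nat flip: ennreal_mult)
  also have "\<dots> \<le> (emeasure unif C + ennreal (6 / of_int K)) * (\<integral>\<^sup>+x. h x \<partial>unif)"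
  proof (intro mult_right_mono)
    have "real (card (G1 \<union> G2)) \<le> real (card G1) + 6"
      using card_Un_le[of G1 G2] card_G2 by linarith
    then have "ennreal (real (card (G1 \<union> G2)) / of_int K) \<le> ennreal (real (card G1) / of_int K + 6 / of_int K)"
      using K0 by (intro ennreal_leI) (simp add: add_divide_distrib[symmetric] divide_right_mono)
    also have "\<dots> = ennreal (real (card G1) / of_int K) + ennreal (6 / of_int K)"
      using K0 by (intro ennreal_plus) auto
    also have "\<dots> \<le> emeasure unif C + ennreal (6 / of_int K)"
      by (intro add_right_mono G1)
    finally show "ennreal (real (card (G1 \<union> G2)) / of_int K) \<le> emeasure unif C + ennreal (6 / of_int K)" .
  qed auto
  finally show ?thesis unfolding C_def .
qed

text \<open>A slice of the hyperbolic region along one axis: s stands for the product of the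
  remaining factors.\<close>

lemma nn_integral_scaled_arc_frac_mult_le:
  fixes h :: "real \<Rightarrow> ennreal" and K :: int
  assumes h: "h \<in> borel_measurable borel" and K: "K \<ge> 1" and a: "0 \<le> a" "a < 1" and s: "0 \<le> s"
  shows "(\<integral>\<^sup>+x. indicator {..r} (s * dist_int (x - a)) * h (frac (of_int K * x)) \<partial>unif) \<le>
    ((\<integral>\<^sup>+x. indicator {..r} (s * dist_int (x - a)) \<partial>unif) + ennreal (6 / of_int K)) * (\<integral>\<^sup>+x. h x \<partial>unif)"
proof -
  \<comment> \<open>For s = 0 the slice is the whole circle or empty; the radii 1 and -1 encode this
    because distances lie in [0,1/2].\<close>
  define r' where "r' = (if s = 0 then if 0 \<le> r then 1 else -1 else r / s)"
  have "s * dist_int y \<le> r \<longleftrightarrow> dist_int y \<le> r'" for y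
    using s dist_int_nonneg[of y] dist_int_le_half[of y] by (auto simp: r'_def field_simps)
  then have eq: "indicator {..r} (s * dist_int (x - a)) = (indicator {x. dist_int (x - a) \<le> r'} x :: ennreal)" for x
    by (simp add: indicator_def)
  show ?thesis
    unfolding eq using nn_integral_arc_frac_mult_le[OF h K a, of r'] by simp
qed

section \<open>Mixing for the product system\<close>

abbreviation cube :: "'i set \<Rightarrow> ('i \<Rightarrow> real) measure" where
  "cube I \<equiv> PiM I (\<lambda>_. unif)"

text \<open>A torus endomorphism read in the fundamental domain. The restriction to I makes the
  value extensional, as points of the product space must be.\<close>

definition expand :: "'i set \<Rightarrow> ('i \<Rightarrow> int) \<Rightarrow> ('i \<Rightarrow> real) \<Rightarrow> 'i \<Rightarrow> real" where
  "expand I K x = (\<lambda>i\<in>I. frac (of_int (K i) * x i))"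

interpretation cube: product_sigma_finite "\<lambda>_. unif" by unfold_locales

lemma prob_space_cube: "prob_space (cube I)"
  by (rule prob_space_PiM) (rule prob_space_unif)

lemma measurable_expand [measurable]: "expand I K \<in> measurable (cube I) (cube I)"
  unfolding expand_def[abs_def] by (rule measurable_restrict) measurable

lemma distr_cube_expand:
  assumes I: "finite I" and K: "\<And>i. i \<in> I \<Longrightarrow> K i \<ge> 1"
  shows "distr (cube I) (cube I) (expand I K) = cube I"
proof (rule cube.PiM_eqI)
  fix A :: "'a \<Rightarrow> real set" assume A: "\<And>i. i \<in> I \<Longrightarrow> A i \<in> sets unif"
  have pre: "(\<lambda>x. frac (of_int (K i) * x)) -` A i \<in> sets unif" if "i \<in> I" for i
    using A[OF that] measurable_sets[of "\<lambda>x. frac (of_int (K i) * x)" borel borel "A i"] by simp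
  have "emeasure (distr (cube I) (cube I) (expand I K)) (Pi\<^sub>E I A) =
      emeasure (cube I) (expand I K -` Pi\<^sub>E I A \<inter> space (cube I))"
    using A I by (intro emeasure_distr sets_PiM_I_finite) auto
  also have "expand I K -` Pi\<^sub>E I A \<inter> space (cube I) = (\<Pi>\<^sub>E i\<in>I. (\<lambda>x. frac (of_int (K i) * x)) -` A i)"
    by (auto simp: expand_def space_PiM PiE_iff)
  also have "emeasure (cube I) \<dots> = (\<Prod>i\<in>I. emeasure unif ((\<lambda>x. frac (of_int (K i) * x)) -` A i))"
    using I pre by (intro cube.emeasure_PiM) auto
  also have "\<dots> = (\<Prod>i\<in>I. emeasure unif (A i))"
  proof (rule prod.cong)
    fix i assume i: "i \<in> I"
    have "emeasure unif ((\<lambda>x. frac (of_int (K i) * x)) -` A i) =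
        (\<integral>\<^sup>+x. indicator (A i) (frac (of_int (K i) * x)) \<partial>unif)"
      using pre[OF i]
      by (subst nn_integral_indicator[symmetric], simp, intro nn_integral_cong) (simp split: split_indicator)
    also have "\<dots> = emeasure unif (A i)"
      using A[OF i] K[OF i] by (subst nn_integral_unif_frac_mult) auto
    finally show "emeasure unif ((\<lambda>x. frac (of_int (K i) * x)) -` A i) = emeasure unif (A i)" .
  qed simp
  finally show "emeasure (distr (cube I) (cube I) (expand I K)) (Pi\<^sub>E I A) = (\<Prod>i\<in>I. emeasure unif (A i))" .
qed (auto intro: I)

lemma nn_integral_cube_expand:
  assumes I: "finite I" and K: "\<And>i. i \<in> I \<Longrightarrow> K i \<ge> 1" and [measurable]: "h \<in> borel_measurable (cube I)"
  shows "(\<integral>\<^sup>+x. h (expand I K x) \<partial>cube I) = (\<integral>\<^sup>+x. h x \<partial>cube I)"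
proof -
  have "(\<integral>\<^sup>+x. h x \<partial>cube I) = (\<integral>\<^sup>+x. h x \<partial>distr (cube I) (cube I) (expand I K))"
    using distr_cube_expand[OF I K] by simp
  also have "\<dots> = (\<integral>\<^sup>+x. h (expand I K x) \<partial>cube I)"
    by (rule nn_integral_distr) auto
  finally show ?thesis ..
qed

lemma measurable_prod_dist_int [measurable]:
  "(\<lambda>x. \<Prod>i\<in>I. dist_int (x i - a i)) \<in> borel_measurable (cube I)"
  by (rule borel_measurable_prod) measurable

text \<open>
  Coordinatewise induction: every line parallel to an axis meets the region in an arc. The factor
  \<open>p\<close> absorbs the coordinate that is split off.
\<close>
lemma nn_integral_star_expand_le:
  fixes h :: "('i \<Rightarrow> real) \<Rightarrow> ennreal" and K :: "'i \<Rightarrow> int" and a :: "'i \<Rightarrow> real"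
  assumes "finite I" and "\<And>i. i \<in> I \<Longrightarrow> K i \<ge> 1" and "\<And>i. i \<in> I \<Longrightarrow> 0 \<le> a i \<and> a i < 1"
    and "0 \<le> p" and "h \<in> borel_measurable (cube I)"
  shows "(\<integral>\<^sup>+x. indicator {..r} (p * (\<Prod>i\<in>I. dist_int (x i - a i))) * h (expand I K x) \<partial>cube I) \<le>
    ((\<integral>\<^sup>+x. indicator {..r} (p * (\<Prod>i\<in>I. dist_int (x i - a i))) \<partial>cube I) + (\<Sum>i\<in>I. ennreal (6 / of_int (K i)))) *
      (\<integral>\<^sup>+x. h x \<partial>cube I)"
  using assms
proof (induction I arbitrary: p h rule: finite_induct)
  case empty
  then show ?case
    by (simp add: cube.nn_integral_empty expand_def restrict_def ac_simps)
next
  case (insert j I)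
  interpret prob_space "cube I" by (rule prob_space_cube)
  define D where "D x = (\<Prod>i\<in>I. dist_int (x i - a i))" for x
  define \<epsilon> where "\<epsilon> = ennreal (6 / of_int (K j))"
  \<comment> \<open>Integrating one coordinate out of an indicator leaves a general function of the
    others; the induction therefore runs over all nonnegative h.\<close>
  define g where "g x = (\<integral>\<^sup>+z. h (x(j := z)) \<partial>unif)" for x
  define ind where "ind x y = (indicator {..r} (p * D x * dist_int (y - a j)) :: ennreal)" for x y
  have D_nonneg: "0 \<le> D x" for x
    by (simp add: D_def prod_nonneg dist_int_nonneg)
  have [measurable]: "h \<in> borel_measurable (cube (insert j I))" by fact
  have [measurable]: "D \<in> borel_measurable (cube I)"
    unfolding D_def[abs_def] by measurable
  have [measurable]: "g \<in> borel_measurable (cube I)"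
    unfolding g_def[abs_def] by measurable
  have [measurable]: "(\<lambda>(x, y). ind x y) \<in> borel_measurable (cube I \<Otimes>\<^sub>M unif)"
    unfolding ind_def by measurable
  have [measurable]: "(\<lambda>(y, x). ind x y) \<in> borel_measurable (unif \<Otimes>\<^sub>M cube I)"
    unfolding ind_def by measurable
  have D_upd: "(\<Prod>i\<in>insert j I. dist_int ((x(j := y)) i - a i)) = dist_int (y - a j) * D x" for x y
    using insert.hyps unfolding D_def by (subst prod.insert) (auto intro!: prod.cong)
  have expand_upd: "expand (insert j I) K (x(j := y)) = (expand I K x)(j := frac (of_int (K j) * y))" for x y
    using insert.hyps by (auto simp: expand_def fun_eq_iff)
  have ind_eq: "indicator {..r} (p * (\<Prod>i\<in>insert j I. dist_int ((x(j := y)) i - a i))) = ind x y" for x y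
    unfolding D_upd ind_def by (simp add: ac_simps)
  have meas: "(\<lambda>x. p * (\<Prod>i\<in>insert j I. dist_int (x i - a i))) \<in> borel_measurable (cube (insert j I))"
    by measurable
  have [measurable]: "(\<lambda>x. indicator {..r} (p * (\<Prod>i\<in>insert j I. dist_int (x i - a i))) :: ennreal)
      \<in> borel_measurable (cube (insert j I))"
    using meas by measurable
  have int_h: "(\<integral>\<^sup>+x. h x \<partial>cube (insert j I)) = (\<integral>\<^sup>+x. g x \<partial>cube I)"
    using insert.hyps by (subst cube.product_nn_integral_insert) (auto simp: g_def[abs_def])
  have int_ind: "(\<integral>\<^sup>+x. indicator {..r} (p * (\<Prod>i\<in>insert j I. dist_int (x i - a i))) \<partial>cube (insert j I)) =
      (\<integral>\<^sup>+y. \<integral>\<^sup>+x. ind x y \<partial>cube I \<partial>unif)"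
    using insert.hyps by (subst cube.product_nn_integral_insert_rev) (auto simp: ind_eq simp del: fun_upd_apply prod.insert)
  have "(\<integral>\<^sup>+x. indicator {..r} (p * (\<Prod>i\<in>insert j I. dist_int (x i - a i))) * h (expand (insert j I) K x)
        \<partial>cube (insert j I)) =
      (\<integral>\<^sup>+x. \<integral>\<^sup>+y. ind x y * h ((expand I K x)(j := frac (of_int (K j) * y))) \<partial>unif \<partial>cube I)"
    using insert.hyps
    by (subst cube.product_nn_integral_insert) (auto simp: ind_eq expand_upd simp del: fun_upd_apply prod.insert)
  also have "\<dots> \<le> (\<integral>\<^sup>+x. ((\<integral>\<^sup>+y. ind x y \<partial>unif) + \<epsilon>) * g (expand I K x) \<partial>cube I)"
  proof (intro nn_integral_mono)
    fix x assume x: "x \<in> space (cube I)"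
    then have [measurable]: "expand I K x \<in> space (cube I)"
      using measurable_space[OF measurable_expand] by blast
    have m: "(\<lambda>z. h ((expand I K x)(j := z))) \<in> borel_measurable borel"
      by measurable
    show "(\<integral>\<^sup>+y. ind x y * h ((expand I K x)(j := frac (of_int (K j) * y))) \<partial>unif) \<le>
        ((\<integral>\<^sup>+y. ind x y \<partial>unif) + \<epsilon>) * g (expand I K x)"
      unfolding ind_def \<epsilon>_def g_def
      using nn_integral_scaled_arc_frac_mult_le[OF m, of "K j" "a j" "p * D x" r] insert.prems D_nonneg
      by simp
  qed
  also have "\<dots> = (\<integral>\<^sup>+x. (\<integral>\<^sup>+y. ind x y * g (expand I K x) \<partial>unif) + \<epsilon> * g (expand I K x) \<partial>cube I)"
    by (intro nn_integral_cong, subst nn_integral_multc) (auto simp: distrib_right)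
  also have "\<dots> = (\<integral>\<^sup>+x. \<integral>\<^sup>+y. ind x y * g (expand I K x) \<partial>unif \<partial>cube I) + \<epsilon> * (\<integral>\<^sup>+x. g (expand I K x) \<partial>cube I)"
    by (simp add: nn_integral_add nn_integral_cmult)
  \<comment> \<open>The error term no longer contains the indicator of the region, so invariance of
    the measure evaluates it exactly. Hence the errors of the coordinates add up without cross
    terms.\<close>
  also have "(\<integral>\<^sup>+x. g (expand I K x) \<partial>cube I) = (\<integral>\<^sup>+x. g x \<partial>cube I)"
    using insert by (intro nn_integral_cube_expand) auto
  \<comment> \<open>The induction hypothesis needs the new coordinate y fixed, with its distance
    moved into the factor p; the order of integration is exchanged for that.\<close>
  also have "(\<integral>\<^sup>+x. \<integral>\<^sup>+y. ind x y * g (expand I K x) \<partial>unif \<partial>cube I) =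
      (\<integral>\<^sup>+y. \<integral>\<^sup>+x. ind x y * g (expand I K x) \<partial>cube I \<partial>unif)"
  proof (rule pair_sigma_finite.Fubini'[symmetric])
    show "pair_sigma_finite (cube I) unif"
      by (intro pair_sigma_finite.intro sigma_finite_measure_axioms unif.sigma_finite_measure_axioms)
  qed measurable
  also have "\<dots> \<le> (\<integral>\<^sup>+y. ((\<integral>\<^sup>+x. ind x y \<partial>cube I) + (\<Sum>i\<in>I. ennreal (6 / of_int (K i)))) * (\<integral>\<^sup>+x. g x \<partial>cube I) \<partial>unif)"
  proof (intro nn_integral_mono)
    fix y
    have "ind x y = indicator {..r} ((p * dist_int (y - a j)) * (\<Prod>i\<in>I. dist_int (x i - a i)))" for x
      by (simp add: ind_def D_def ac_simps)
    then show "(\<integral>\<^sup>+x. ind x y * g (expand I K x) \<partial>cube I) \<le>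
        ((\<integral>\<^sup>+x. ind x y \<partial>cube I) + (\<Sum>i\<in>I. ennreal (6 / of_int (K i)))) * (\<integral>\<^sup>+x. g x \<partial>cube I)"
      using insert.IH[of "p * dist_int (y - a j)" g] insert.prems by (simp add: dist_int_nonneg)
  qed
  also have "\<dots> = ((\<integral>\<^sup>+y. \<integral>\<^sup>+x. ind x y \<partial>cube I \<partial>unif) + (\<Sum>i\<in>I. ennreal (6 / of_int (K i)))) * (\<integral>\<^sup>+x. g x \<partial>cube I)"
    by (simp add: nn_integral_multc nn_integral_add unif.emeasure_space_1[simplified])
  finally show ?case
    unfolding int_h int_ind \<epsilon>_def using insert.hyps
    by (simp add: distrib_right distrib_left ac_simps add_right_mono)
qed

section \<open>Measure of the hyperbolic region\<close>

lemma exponential_distributed_dist_int: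
  assumes i: "i \<in> I"
  shows "distributed (cube I) lborel (\<lambda>x. -ln (2 * dist_int (x i - a))) (exponential_density 1)"
proof (rule exponential_distributedI)
  show [measurable]: "(\<lambda>x. -ln (2 * dist_int (x i - a))) \<in> borel_measurable (cube I)"
    using i by measurable
  fix b :: real assume b: "0 \<le> b"
  have "emeasure (cube I) {x \<in> space (cube I). -ln (2 * dist_int (x i - a)) \<le> b} =
      emeasure (distr (cube I) unif (\<lambda>x. x i)) {y. -ln (2 * dist_int (y - a)) \<le> b}"
    using i by (subst emeasure_distr) (auto intro!: arg_cong2[where f = emeasure])
  also have "distr (cube I) unif (\<lambda>x. x i) = unif"
    by (rule distr_PiM_component[OF _ i]) (rule prob_space_unif)
  also have "{y. -ln (2 * dist_int (y - a)) \<le> b} =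
      UNIV - {y. 0 < dist_int (y - a) \<and> dist_int (y - a) < exp (-b) / 2}"
  proof -
    \<comment> \<open>At u = 0 the left side holds because ln 0 = 0 and b is nonnegative, so 0 must
      be removed from the arc on the right.\<close>
    have "-ln (2 * u) \<le> b \<longleftrightarrow> \<not> (0 < u \<and> u < exp (-b) / 2)" if "0 \<le> u" for u :: real
    proof (cases "u = 0")
      case False
      then have "-ln (2 * u) \<le> b \<longleftrightarrow> exp (-b) \<le> 2 * u"
        using that ln_ge_iff[of "2 * u" "-b"] by auto
      then show ?thesis using False that by auto
    qed (use b in simp)
    from this[OF dist_int_nonneg] show ?thesis by blast
  qed
  also have "emeasure unif \<dots> = 1 - ennreal (exp (-b * 1))"
  proof -
    let ?S = "{y. 0 < dist_int (y - a) \<and> dist_int (y - a) < exp (-b) / 2}"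
    have "unif.prob ?S = exp (-b)"
      using emeasure_unif_dist_int[of "exp (-b) / 2" a] b by (simp add: unif.emeasure_eq_measure)
    moreover have "unif.prob (space unif - ?S) = 1 - unif.prob ?S"
      by (rule unif.prob_compl) simp
    ultimately show ?thesis by (simp add: unif.emeasure_eq_measure ennreal_minus flip: ennreal_1)
  qed
  finally show "emeasure (cube I) {x \<in> space (cube I). -ln (2 * dist_int (x i - a)) \<le> b} =
      1 - ennreal (exp (-b * 1))" .
qed simp

lemma indep_vars_cube:
  assumes "finite I" "I \<noteq> {}"
  shows "prob_space.indep_vars (cube I) (\<lambda>_. unif) (\<lambda>i x. x i) I"
proof -
  interpret prob_space "cube I" by (rule prob_space_cube)
  have "distr (cube I) (cube I) (\<lambda>x. \<lambda>i\<in>I. x i) = distr (cube I) (cube I) (\<lambda>x. x)"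
    by (rule distr_cong) (auto simp: space_PiM restrict_PiE_iff)
  then have "distr (cube I) (cube I) (\<lambda>x. \<lambda>i\<in>I. x i) = cube I"
    by (simp add: distr_id)
  moreover have "(\<Pi>\<^sub>M i\<in>I. distr (cube I) unif (\<lambda>x. x i)) = cube I"
    by (intro PiM_cong refl distr_PiM_component prob_space_unif)
  ultimately show ?thesis
    using assms by (subst indep_vars_iff_distr_eq_PiM') auto
qed

text \<open>
  The variables \<open>-ln (2 \<parallel>x\<^sub>i - a\<^sub>i\<parallel>)\<close> are independent and exponentially distributed, so their sum has an
  Erlang distribution, whose tail is the stated sum.
\<close>
lemma measure_cube_star:
  fixes a :: "'i \<Rightarrow> real"
  assumes I: "finite I" "I \<noteq> {}" and c: "0 < c" "2 ^ card I * c \<le> 1"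
  shows "measure (cube I) {x \<in> space (cube I). (\<Prod>i\<in>I. dist_int (x i - a i)) \<le> c} =
    2 ^ card I * c * (\<Sum>s<card I. 1 / fact s * ln (1 / (2 ^ card I * c)) ^ s)"
proof -
  interpret prob_space "cube I" by (rule prob_space_cube)
  define X where "X i x = -ln (2 * dist_int (x i - a i))" for i and x :: "'i \<Rightarrow> real"
  define L where "L = ln (1 / (2 ^ card I * c))"
  have L: "0 \<le> L" unfolding L_def using c by (subst ln_ge_zero_iff) (auto simp: field_simps)
  have expL: "exp (-L) = 2 ^ card I * c" unfolding L_def using c by (simp add: ln_div)
  have ind: "indep_vars (\<lambda>_. borel) X I"
    using indep_vars_compose2[OF indep_vars_cube[OF I], of "\<lambda>i y. -ln (2 * dist_int (y - a i))" "\<lambda>_. borel"]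
    unfolding X_def by simp
  \<comment> \<open>The Erlang index is the number of summands minus one.\<close>
  have dst: "distributed (cube I) lborel (\<lambda>x. \<Sum>i\<in>I. X i x) (erlang_density (card I - 1) 1)"
    by (rule exponential_distributed_sum[OF I _ _ ind])
       (auto simp: X_def[abs_def] intro!: exponential_distributed_dist_int)
  have [measurable]: "(\<lambda>x. \<Sum>i\<in>I. X i x) \<in> borel_measurable (cube I)"
    using distributed_measurable[OF dst] by simp
  have nonzero: "AE x in cube I. \<forall>i\<in>I. dist_int (x i - a i) \<noteq> 0"
  proof (intro eventually_ball_finite ballI I AE_PiM_component)
    fix i
    show "AE y in unif. dist_int (y - a i) \<noteq> 0"
      by (rule AE_I[OF _ emeasure_unif_dist_int_0[of "a i"]]) (auto, measurable)
  qed (rule prob_space_unif)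
  \<comment> \<open>The closed condition on the product becomes L <= sum, while the Erlang tail is
    stated for L < sum; having a density, the sum has no atom at L.\<close>
  have "AE y in distr (cube I) lborel (\<lambda>x. \<Sum>i\<in>I. X i x). y \<noteq> L"
    unfolding distributed_distr_eq_density[OF dst]
    by (subst AE_density) (auto intro: AE_mp[OF AE_lborel_singleton[of L]])
  then have neq: "AE x in cube I. (\<Sum>i\<in>I. X i x) \<noteq> L"
    by (subst (asm) AE_distr_iff) auto
  have "prob {x \<in> space (cube I). (\<Prod>i\<in>I. dist_int (x i - a i)) \<le> c} =
      prob {x \<in> space (cube I). L < (\<Sum>i\<in>I. X i x)}"
  proof (rule prob_eq_AE)
    show "AE x in cube I. (\<Prod>i\<in>I. dist_int (x i - a i)) \<le> c \<longleftrightarrow> L < (\<Sum>i\<in>I. X i x)"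
      using nonzero neq
    proof eventually_elim
      case (elim x)
      then have pos: "0 < dist_int (x i - a i)" if "i \<in> I" for i
        using that dist_int_nonneg[of "x i - a i"] by (simp add: less_le)
      have "(\<Sum>i\<in>I. X i x) = -ln (\<Prod>i\<in>I. 2 * dist_int (x i - a i))"
        unfolding X_def sum_negf using pos elim I by (subst ln_prod) auto
      also have "(\<Prod>i\<in>I. 2 * dist_int (x i - a i)) = 2 ^ card I * (\<Prod>i\<in>I. dist_int (x i - a i))"
        by (simp add: prod.distrib)
      finally have sum: "(\<Sum>i\<in>I. X i x) = -ln (2 ^ card I * (\<Prod>i\<in>I. dist_int (x i - a i)))" .
      have ppos: "0 < (\<Prod>i\<in>I. dist_int (x i - a i))"
        using pos by (rule prod_pos)
      have "(\<Prod>i\<in>I. dist_int (x i - a i)) \<le> c \<longleftrightarrow>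
          ln (2 ^ card I * (\<Prod>i\<in>I. dist_int (x i - a i))) \<le> ln (2 ^ card I * c)"
        using c ppos by (subst ln_le_cancel_iff) auto
      also have "\<dots> \<longleftrightarrow> L \<le> (\<Sum>i\<in>I. X i x)"
        unfolding sum L_def using c by (simp add: ln_div)
      finally show ?case using elim by auto
    qed
  qed measurable
  also have "\<dots> = 1 - erlang_CDF (card I - 1) 1 L"
    by (rule erlang_distributed_gt[OF dst _ L]) simp
  also have "\<dots> = (\<Sum>s\<le>card I - 1. L ^ s * exp (-L) / fact s)"
    using L by (simp add: erlang_CDF_def)
  also have "{..card I - 1} = {..<card I}"
    using I by (cases "card I") (auto simp: card_eq_0_iff)
  also have "(\<Sum>s<card I. L ^ s * exp (-L) / fact s) = 2 ^ card I * c * (\<Sum>s<card I. 1 / fact s * L ^ s)"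
    by (simp add: expL sum_distrib_left field_simps)
  finally show ?thesis unfolding L_def .
qed

section \<open>Correlation of the target events\<close>

text \<open>The level c is decoupled from the time n, so that one region can be compared at
  different times.\<close>

definition hits :: "'i set \<Rightarrow> ('i \<Rightarrow> int) \<Rightarrow> ('i \<Rightarrow> real) \<Rightarrow> real \<Rightarrow> nat \<Rightarrow> ('i \<Rightarrow> real) set" where
  "hits I t a c n = {x \<in> space (cube I). (\<Prod>i\<in>I. dist_int (of_int (t i) ^ n * x i - a i)) \<le> c}"

lemma sets_hits [measurable]: "hits I t a c n \<in> sets (cube I)"
proof -
  have "(\<lambda>x. \<Prod>i\<in>I. dist_int (of_int (t i) ^ n * x i - a i)) \<in> borel_measurable (cube I)"
    by (rule borel_measurable_prod) measurable
  then show ?thesis unfolding hits_def by measurable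
qed

lemma prod_dist_int_expand:
  "(\<Prod>i\<in>I. dist_int (of_int (s i) * expand I K x i - a i)) = (\<Prod>i\<in>I. dist_int (of_int (s i * K i) * x i - a i))"
  by (intro prod.cong) (simp_all add: expand_def dist_int_mult_frac mult.assoc)

lemma indicator_hits:
  assumes "x \<in> space (cube I)"
  shows "indicator (hits I t a c (m + k)) x =
    indicator {..c} (\<Prod>i\<in>I. dist_int (of_int (t i) ^ k * expand I (\<lambda>i. t i ^ m) x i - a i))"
  using assms prod_dist_int_expand[of "\<lambda>i. t i ^ k" I "\<lambda>i. t i ^ m" x a]
  by (simp add: hits_def indicator_def power_add mult.commute)

text \<open>Stationarity: events at times m and m + k are preimages under the measure-preserving
  expansion by \<open>t i ^ m\<close> of events at times 0 and k, so only the lag k matters.\<close>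

lemma emeasure_hits_add:
  assumes I: "finite I" and t: "\<And>i. i \<in> I \<Longrightarrow> t i \<ge> 1"
  shows "emeasure (cube I) (hits I t a c (m + k)) =
      (\<integral>\<^sup>+x. indicator {..c} (\<Prod>i\<in>I. dist_int (of_int (t i) ^ k * x i - a i)) \<partial>cube I)" 
    and "emeasure (cube I) (hits I t a c m \<inter> hits I t a c' (m + k)) =
      (\<integral>\<^sup>+x. indicator {..c} (\<Prod>i\<in>I. dist_int (x i - a i)) *
        indicator {..c'} (\<Prod>i\<in>I. dist_int (of_int (t i) ^ k * x i - a i)) \<partial>cube I)" 
proof -
  have tm: "t i ^ m \<ge> 1" if "i \<in> I" for i using t[OF that] by simp
  have [measurable]: "(\<lambda>x. \<Prod>i\<in>I. dist_int (of_int (t i) ^ k * x i - a i)) \<in> borel_measurable (cube I)" for k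
    by (rule borel_measurable_prod) measurable
  have [measurable]: "(\<lambda>x. indicator {..c} (\<Prod>i\<in>I. dist_int (of_int (t i) ^ k * x i - a i)) :: ennreal)
      \<in> borel_measurable (cube I)" for k c
    by measurable
  have "emeasure (cube I) (hits I t a c (m + k)) = (\<integral>\<^sup>+x. indicator (hits I t a c (m + k)) x \<partial>cube I)"
    by (rule nn_integral_indicator[symmetric]) measurable
  also have "\<dots> = (\<integral>\<^sup>+x. (indicator {..c} (\<Prod>i\<in>I. dist_int (of_int (t i) ^ k * expand I (\<lambda>i. t i ^ m) x i - a i))) \<partial>cube I)"
    by (intro nn_integral_cong indicator_hits)
  also have "\<dots> = (\<integral>\<^sup>+x. indicator {..c} (\<Prod>i\<in>I. dist_int (of_int (t i) ^ k * x i - a i)) \<partial>cube I)"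
    by (rule nn_integral_cube_expand[OF I tm]) measurable
  finally show "emeasure (cube I) (hits I t a c (m + k)) =
      (\<integral>\<^sup>+x. indicator {..c} (\<Prod>i\<in>I. dist_int (of_int (t i) ^ k * x i - a i)) \<partial>cube I)" .
  have "emeasure (cube I) (hits I t a c m \<inter> hits I t a c' (m + k)) =
      (\<integral>\<^sup>+x. indicator (hits I t a c m \<inter> hits I t a c' (m + k)) x \<partial>cube I)"
    by (rule nn_integral_indicator[symmetric]) measurable
  also have "\<dots> = (\<integral>\<^sup>+x. indicator {..c} (\<Prod>i\<in>I. dist_int (of_int (t i) ^ 0 * expand I (\<lambda>i. t i ^ m) x i - a i)) *
      indicator {..c'} (\<Prod>i\<in>I. dist_int (of_int (t i) ^ k * expand I (\<lambda>i. t i ^ m) x i - a i)) \<partial>cube I)"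
    by (intro nn_integral_cong)
       (simp add: indicator_inter_arith indicator_hits[of _ I t a c m 0, simplified] indicator_hits)
  also have "\<dots> = (\<integral>\<^sup>+x. indicator {..c} (\<Prod>i\<in>I. dist_int (of_int (t i) ^ 0 * x i - a i)) *
        indicator {..c'} (\<Prod>i\<in>I. dist_int (of_int (t i) ^ k * x i - a i)) \<partial>cube I)"
    by (rule nn_integral_cube_expand[OF I tm]) measurable
  finally show "emeasure (cube I) (hits I t a c m \<inter> hits I t a c' (m + k)) =
      (\<integral>\<^sup>+x. indicator {..c} (\<Prod>i\<in>I. dist_int (x i - a i)) *
        indicator {..c'} (\<Prod>i\<in>I. dist_int (of_int (t i) ^ k * x i - a i)) \<partial>cube I)"
    by simp
qed

lemma measure_hits:
  assumes I: "finite I" "I \<noteq> {}" and c: "0 < c" "2 ^ card I * c \<le> 1" and t: "\<And>i. i \<in> I \<Longrightarrow> t i \<ge> 1"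
  shows "measure (cube I) (hits I t a c n) =
    2 ^ card I * c * (\<Sum>s<card I. 1 / fact s * ln (1 / (2 ^ card I * c)) ^ s)"
proof -
  have "emeasure (cube I) (hits I t a c n) = emeasure (cube I) (hits I t a c 0)"
    using emeasure_hits_add(1)[where m = n and k = 0, OF I(1) t]
      emeasure_hits_add(1)[where m = 0 and k = 0, OF I(1) t] by simp
  then have "measure (cube I) (hits I t a c n) = measure (cube I) (hits I t a c 0)"
    by (simp add: measure_def)
  then show ?thesis
    using measure_cube_star[OF I c, of a] by (simp add: hits_def)
qed

text \<open>Stationarity moves the earlier event to time 0, where it is the region itself, while the
  later one is the preimage of a region under expansion by \<open>t i ^ (n - m)\<close>. Each
  coordinate contributes an error 6 / \<open>t i ^ (n - m)\<close>, and t i >= 2 turns this into a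
  geometric decay.\<close>

lemma measure_hits_Int_le:
  assumes I: "finite I" and t: "\<And>i. i \<in> I \<Longrightarrow> t i \<ge> 2" and a: "\<And>i. i \<in> I \<Longrightarrow> 0 \<le> a i \<and> a i < 1"
    and mn: "m < n"
  shows "measure (cube I) (hits I t a c m \<inter> hits I t a c' n) \<le>
    (measure (cube I) (hits I t a c m) + 6 * real (card I) * (1 / 2) ^ (n - m)) * measure (cube I) (hits I t a c' n)"
proof -
  interpret prob_space "cube I" by (rule prob_space_cube)
  define k where "k = n - m"
  have n: "n = m + k" using mn by (simp add: k_def)
  have t1: "t i \<ge> 1" if "i \<in> I" for i using t[OF that] by simp
  let ?D = "\<lambda>x. \<Prod>i\<in>I. dist_int (x i - a i)"
  have h[measurable]: "(\<lambda>x. indicator {..c'} (?D x) :: ennreal) \<in> borel_measurable (cube I)"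
    by measurable
  have hit_eq: "emeasure (cube I) (hits I t a c j) = (\<integral>\<^sup>+x. indicator {..c} (?D x) \<partial>cube I)" for c j
    using emeasure_hits_add(1)[where k = 0, OF I t1] by simp
  have D_exp: "?D (expand I (\<lambda>i. t i ^ k) x) = (\<Prod>i\<in>I. dist_int (of_int (t i) ^ k * x i - a i))" for x
    using prod_dist_int_expand[of "\<lambda>_. 1" I "\<lambda>i. t i ^ k" x a] by simp
  have "emeasure (cube I) (hits I t a c m \<inter> hits I t a c' n) =
      (\<integral>\<^sup>+x. indicator {..c} (1 * ?D x) * indicator {..c'} (?D (expand I (\<lambda>i. t i ^ k) x)) \<partial>cube I)"
    using emeasure_hits_add(2)[OF I t1] by (simp add: n D_exp)
  also have "\<dots> \<le> ((\<integral>\<^sup>+x. indicator {..c} (1 * ?D x) \<partial>cube I) + (\<Sum>i\<in>I. ennreal (6 / of_int (t i ^ k)))) *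
      (\<integral>\<^sup>+x. indicator {..c'} (?D x) \<partial>cube I)"
    using t1 a by (intro nn_integral_star_expand_le[OF I _ _ _ h]) auto
  also have "\<dots> = (emeasure (cube I) (hits I t a c m) + (\<Sum>i\<in>I. ennreal (6 / of_int (t i ^ k)))) *
      emeasure (cube I) (hits I t a c' n)"
    by (simp add: hit_eq)
  also have "(\<Sum>i\<in>I. ennreal (6 / of_int (t i ^ k))) \<le> (\<Sum>i\<in>I. ennreal (6 * (1 / 2) ^ k))"
  proof (intro sum_mono ennreal_leI)
    fix i assume "i \<in> I"
    then have "(2::real) ^ k \<le> of_int (t i) ^ k" using t[of i] by (intro power_mono) auto
    then have "6 / real_of_int (t i) ^ k \<le> 6 / 2 ^ k"
      using order_less_le_trans[of 0 "(2::real) ^ k"] by (intro divide_left_mono) auto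
    then show "6 / real_of_int (t i ^ k) \<le> 6 * (1 / 2) ^ k" by (simp add: power_divide)
  qed
  also have "(\<Sum>i\<in>I. ennreal (6 * (1 / 2) ^ k)) = ennreal (6 * real (card I) * (1 / 2) ^ k)"
    by (simp add: ennreal_of_nat_eq_real_of_nat ac_simps flip: ennreal_mult)
  finally have "ennreal (prob (hits I t a c m \<inter> hits I t a c' n)) \<le>
      (ennreal (prob (hits I t a c m)) + ennreal (6 * real (card I) * (1 / 2) ^ k)) * ennreal (prob (hits I t a c' n))"
    by (simp add: emeasure_eq_measure mult_right_mono add_left_mono)
  also have "\<dots> = ennreal ((prob (hits I t a c m) + 6 * real (card I) * (1 / 2) ^ k) * prob (hits I t a c' n))"
    by (simp flip: ennreal_plus ennreal_mult)
  finally show ?thesis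
    by (subst (asm) ennreal_le_iff) (auto simp: k_def)
qed

section \<open>Almost sure counting for quasi-independent events\<close>

text \<open>The telescoping terms are increments over the dyadic blocks given by the binary digits of \<open>j\<close>.\<close>
lemma dyadic_chaining:
  fixes f :: "nat \<Rightarrow> real"
  assumes j: "j < 2 ^ r"
  shows "(f j - f 0)\<^sup>2 \<le> real r * (\<Sum>s<r. \<Sum>i<2 ^ (r - s). (f (Suc i * 2 ^ s) - f (i * 2 ^ s))\<^sup>2)"
proof -
  \<comment> \<open>\<open>j div 2 ^ s * 2 ^ s\<close> clears the lowest s binary digits of j.
    Consecutive values coincide when digit s is 0 and otherwise differ by one dyadic block of length
    2^s.\<close>
  define c where "c s = f (j div 2 ^ s * 2 ^ s) - f (j div 2 ^ Suc s * 2 ^ Suc s)" for s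
  have "(\<Sum>s<r. c s) = f (j div 2 ^ 0 * 2 ^ 0) - f (j div 2 ^ r * 2 ^ r)"
    unfolding c_def by (rule sum_lessThan_telescope')
  then have "f j - f 0 = (\<Sum>s<r. c s)" using j by simp
  also have "(\<Sum>s<r. c s)\<^sup>2 \<le> real r * (\<Sum>s<r. (c s)\<^sup>2)"
    using sum_squared_le_sum_of_squares[of c "{..<r}"] by (simp add: mult.commute)
  also have "\<dots> \<le> real r * (\<Sum>s<r. \<Sum>i<2 ^ (r - s). (f (Suc i * 2 ^ s) - f (i * 2 ^ s))\<^sup>2)"
  proof (intro mult_left_mono sum_mono)
    fix s assume "s \<in> {..<r}"
    then have s: "s < r" by simp
    define q where "q = j div 2 ^ s"
    have q2: "j div 2 ^ Suc s = q div 2" by (simp add: q_def div_mult2_eq power_Suc2 del: power_Suc)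
    have q: "q < 2 ^ (r - s)"
      unfolding q_def using j s by (simp add: div_less_iff_less_mult flip: power_add)
    show "(c s)\<^sup>2 \<le> (\<Sum>i<2 ^ (r - s). (f (Suc i * 2 ^ s) - f (i * 2 ^ s))\<^sup>2)"
    proof (cases "even q")
      case True
      then have "q div 2 * 2 ^ Suc s = q * 2 ^ s" by (auto elim!: evenE)
      then have "c s = 0" unfolding c_def q2 q_def[symmetric] by (simp only: diff_self)
      then show ?thesis by (simp add: sum_nonneg)
    next
      case False
      then obtain p where p: "q = Suc (2 * p)" by (auto elim!: oddE)
      then have "c s = f (Suc (2 * p) * 2 ^ s) - f (2 * p * 2 ^ s)"
        unfolding c_def q2 q_def[symmetric] by (simp add: ac_simps)
      then show ?thesis
        using p q member_le_sum[of "2 * p" "{..<2 ^ (r - s)}" "\<lambda>i. (f (Suc i * 2 ^ s) - f (i * 2 ^ s))\<^sup>2"]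
        by simp
    qed
  qed simp
  finally show ?thesis .
qed

text \<open>One random series handles all j at once: the normalised sums \<open>R r x / w r\<close>
  have summable expectations, so almost surely they share a finite bound, and chaining passes it on
  to every \<open>f j x\<close>.\<close>

lemma (in prob_space) AE_bound_of_increment_variance:
  fixes f :: "nat \<Rightarrow> 'a \<Rightarrow> real"
  assumes f0: "\<And>x. f 0 x = 0" and [measurable]: "\<And>j. f j \<in> borel_measurable M"
    and int: "\<And>u v. u < v \<Longrightarrow> integrable M (\<lambda>x. (f v x - f u x)\<^sup>2)"
    and var: "\<And>u v. u < v \<Longrightarrow> expectation (\<lambda>x. (f v x - f u x)\<^sup>2) \<le> C * real (v - u)"
    and C: "0 \<le> C" and \<epsilon>: "0 < \<epsilon>"
  shows "AE x in M. \<exists>K\<ge>0. \<forall>j. \<bar>f j x\<bar> \<le> K * sqrt (real (Suc j)) * (ln (real (Suc j)) + 1) powr (3 / 2 + \<epsilon>)"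
proof -
  define R where "R r x = (\<Sum>s<r. \<Sum>i<2 ^ (r - s). (f (Suc i * 2 ^ s) x - f (i * 2 ^ s) x)\<^sup>2)" for r x
  \<comment> \<open>The expectation of \<open>R r\<close> is at most C r 2^r, since each of the r
    scales contributes C 2^r. One power of r + 1 pays for the scales; the other 1 + 2
    \<open>\<epsilon>\<close> make the series over r converge.\<close>
  define w where "w r = (real r + 1) powr (2 + 2 * \<epsilon>) * 2 ^ r" for r :: nat
  have w_pos: "0 < w r" for r by (simp add: w_def)
  have [measurable]: "R r \<in> borel_measurable M" for r unfolding R_def[abs_def] by measurable
  have R_nonneg: "0 \<le> R r x" for r x by (simp add: R_def sum_nonneg)
  have int_R: "integrable M (R r)" for r
    unfolding R_def[abs_def] by (intro Bochner_Integration.integrable_sum int) simp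
  have exp_R: "expectation (R r) \<le> C * real r * 2 ^ r" for r
  proof -
    have "expectation (R r) =
        (\<Sum>s<r. \<Sum>i<2 ^ (r - s). expectation (\<lambda>x. (f (Suc i * 2 ^ s) x - f (i * 2 ^ s) x)\<^sup>2))"
      unfolding R_def[abs_def]
      by (subst Bochner_Integration.integral_sum, intro Bochner_Integration.integrable_sum int, simp)
         (intro sum.cong refl Bochner_Integration.integral_sum int, simp)
    also have "\<dots> \<le> (\<Sum>s<r. \<Sum>i::nat<2 ^ (r - s). C * 2 ^ s)"
    proof (intro sum_mono)
      fix s i :: nat
      show "expectation (\<lambda>x. (f (Suc i * 2 ^ s) x - f (i * 2 ^ s) x)\<^sup>2) \<le> C * 2 ^ s"
        using var[of "i * 2 ^ s" "Suc i * 2 ^ s"] by simp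
    qed
    also have "\<dots> = (\<Sum>s<r. C * 2 ^ r)"
      by (intro sum.cong refl) (simp flip: power_add)
    finally show ?thesis by (simp add: ac_simps)
  qed
  have "(\<integral>\<^sup>+x. (\<Sum>r. ennreal (R r x / w r)) \<partial>M) = (\<Sum>r. \<integral>\<^sup>+x. ennreal (R r x / w r) \<partial>M)"
    by (rule nn_integral_suminf) measurable
  also have "\<dots> \<le> (\<Sum>r. ennreal (C * real (Suc r) powr (-1 - 2 * \<epsilon>)))"
  proof (intro suminf_le)
    fix r
    have "(\<integral>\<^sup>+x. ennreal (R r x / w r) \<partial>M) = ennreal (expectation (R r) / w r)"
      using int_R[of r] R_nonneg[of r] w_pos[of r] by (subst nn_integral_eq_integral) auto
    also have "expectation (R r) / w r \<le> C * (real r + 1) * 2 ^ r / w r"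
      using exp_R[of r] w_pos[of r] C
      by (intro divide_right_mono order_trans[OF exp_R] mult_right_mono mult_left_mono) auto
    also have "\<dots> = C * real (Suc r) powr (-1 - 2 * \<epsilon>)"
    proof -
      have "(real r + 1) / (real r + 1) powr (2 + 2 * \<epsilon>) = (real r + 1) powr (1 - (2 + 2 * \<epsilon>))"
        by (subst powr_diff) simp
      moreover have "C * (real r + 1) * 2 ^ r / w r = C * ((real r + 1) / (real r + 1) powr (2 + 2 * \<epsilon>))"
        by (simp add: w_def)
      ultimately show ?thesis by (simp add: add.commute)
    qed
    finally show "(\<integral>\<^sup>+x. ennreal (R r x / w r) \<partial>M) \<le> ennreal (C * real (Suc r) powr (-1 - 2 * \<epsilon>))"
      by (simp add: ennreal_leI)
  qed auto
  also have "\<dots> = ennreal (\<Sum>r. C * real (Suc r) powr (-1 - 2 * \<epsilon>))"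
  proof (rule suminf_ennreal2)
    have "summable (\<lambda>n. real n powr (-1 - 2 * \<epsilon>))"
      using \<epsilon> by (subst summable_real_powr_iff) auto
    then show "summable (\<lambda>r. C * real (Suc r) powr (-1 - 2 * \<epsilon>))"
      by (intro summable_mult) (subst summable_Suc_iff)
  qed (use C in auto)
  finally have "(\<integral>\<^sup>+x. (\<Sum>r. ennreal (R r x / w r)) \<partial>M) \<noteq> \<infinity>"
    by (auto simp: top_unique)
  then have "AE x in M. (\<Sum>r. ennreal (R r x / w r)) \<noteq> \<infinity>"
    by (intro nn_integral_PInf_AE) auto
  then show ?thesis
  proof eventually_elim
    case (elim x)
    then obtain B where B: "0 \<le> B" "(\<Sum>r. ennreal (R r x / w r)) = ennreal B"
      by (cases "(\<Sum>r. ennreal (R r x / w r))") auto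
    have RB: "R r x \<le> B * w r" for r
    proof -
      have "ennreal (R r x / w r) \<le> (\<Sum>r. ennreal (R r x / w r))"
        using sum_le_suminf[of "\<lambda>r. ennreal (R r x / w r)" "{r}"] by simp
      then have "R r x / w r \<le> B" using B by simp
      then show ?thesis using w_pos[of r] by (simp add: field_simps)
    qed
    \<comment> \<open>The factor 2 comes from 2^r <= 2 (j + 1), the power of 2 from r + 1 <= 2 (ln
      (j + 1) + 1).\<close>
    define K where "K = sqrt (2 * B * 2 powr (3 + 2 * \<epsilon>))"
    have "\<bar>f j x\<bar> \<le> K * sqrt (real (Suc j)) * (ln (real (Suc j)) + 1) powr (3 / 2 + \<epsilon>)" for j
    proof -
      \<comment> \<open>Measuring j + 1 instead of j gives j = 0 a binary length too, and still
        yields j < 2^(q + 1).\<close>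
      obtain q where q: "2 ^ q \<le> Suc j" "Suc j < 2 ^ (q + 1)"
        using ex_power_ivl1[of 2 "Suc j"] by auto
      define r where "r = Suc q"
      define l where "l = ln (real (Suc j)) + 1"
      have l: "1 \<le> l" by (simp add: l_def)
      have "real q * ln 2 = ln (real (2 ^ q))" by (simp add: ln_realpow)
      also have "\<dots> \<le> ln (real (Suc j))"
        using q(1) by (subst ln_le_cancel_iff) (simp_all only: of_nat_le_iff, auto)
      finally have "real q * ln 2 \<le> l - 1" by (simp add: l_def)
      moreover have "real q * (1 / 2) \<le> real q * ln 2"
        using ln2_ge_two_thirds by (intro mult_left_mono) auto
      ultimately have rl: "real r + 1 \<le> 2 * l" by (simp add: r_def)
      have "(f j x)\<^sup>2 \<le> real r * R r x"
        using dyadic_chaining[of j r "\<lambda>j. f j x"] q(2) f0 by (simp add: R_def r_def)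
      also have "\<dots> \<le> (real r + 1) * (B * w r)"
        using RB[of r] R_nonneg[of r x] by (intro mult_mono) auto
      also have "\<dots> = B * (real r + 1) powr (3 + 2 * \<epsilon>) * 2 ^ r"
        by (simp add: w_def powr_add field_simps powr_numeral power2_eq_square power3_eq_cube)
      also have "\<dots> \<le> B * (2 * l) powr (3 + 2 * \<epsilon>) * real (2 * Suc j)"
      proof (intro mult_mono mult_left_mono powr_mono2 rl)
        have "real (2 ^ r) \<le> real (2 * Suc j)"
          using q(1) unfolding r_def of_nat_le_iff by simp
        then show "2 ^ r \<le> real (2 * Suc j)" by simp
      qed (use B \<epsilon> l in auto)
      also have "\<dots> = (2 * B * 2 powr (3 + 2 * \<epsilon>)) * real (Suc j) * l powr (3 + 2 * \<epsilon>)"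
        using l by (simp add: powr_mult)
      also have "l powr (3 + 2 * \<epsilon>) = (l powr (3 / 2 + \<epsilon>))\<^sup>2"
        by (simp add: power2_eq_square flip: powr_add)
      finally have "sqrt ((f j x)\<^sup>2) \<le> sqrt ((2 * B * 2 powr (3 + 2 * \<epsilon>)) * real (Suc j) * (l powr (3 / 2 + \<epsilon>))\<^sup>2)"
        by (rule real_sqrt_le_mono)
      then show ?thesis
        by (simp add: real_sqrt_mult K_def l_def del: of_nat_Suc)
    qed
    moreover have "0 \<le> K" by (simp add: K_def B)
    ultimately show ?case by blast
  qed
qed

text \<open>Counts are monotone in time, so control at the block ends B j extends to every n between
  two consecutive ends at the price of a bounded error. Steps of size at most 1 keep
  \<open>\<Phi> (B j)\<close> within 1 of j.\<close>

lemma unit_blocks: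
  fixes \<Phi> :: "nat \<Rightarrow> real"
  assumes \<Phi>0: "\<Phi> 0 = 0" and step: "\<And>n. \<Phi> n < \<Phi> (Suc n)" "\<And>n. \<Phi> (Suc n) \<le> \<Phi> n + 1"
    and lim: "filterlim \<Phi> at_top sequentially"
  obtains B :: "nat \<Rightarrow> nat" where "B 0 = 0" "mono B" "\<And>j. \<Phi> (B j) \<le> real j" "\<And>j. real j - 1 < \<Phi> (B j)"
    "\<And>n. B (nat \<lfloor>\<Phi> n\<rfloor>) \<le> n" "\<And>n. n \<le> B (Suc (nat \<lfloor>\<Phi> n\<rfloor>))"
proof -
  \<comment> \<open>The last index n with \<open>\<Phi> n \<le> real j\<close>: it exists because
    \<open>\<Phi>\<close> starts at 0, increases and is unbounded.\<close>
  define B where "B j = (LEAST n. real j < \<Phi> (Suc n))" for j :: nat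
  have smono: "strict_mono \<Phi>" using step(1) by (simp add: strict_mono_Suc_iff)
  have ex: "\<exists>n. real j < \<Phi> (Suc n)" for j
  proof -
    have "eventually (\<lambda>n. real j < \<Phi> n) sequentially"
      using lim by (simp add: filterlim_at_top_dense)
    then obtain n where "real j < \<Phi> n" by (auto simp: eventually_sequentially)
    then have "real j < \<Phi> (Suc n)" using step(1)[of n] by simp
    then show ?thesis by blast
  qed
  have upper: "real j < \<Phi> (Suc (B j))" for j
    unfolding B_def by (rule LeastI_ex[OF ex])
  have lower: "\<Phi> (B j) \<le> real j" for j
  proof (cases "B j")
    case (Suc m)
    then have "\<not> real j < \<Phi> (Suc m)"
      using not_less_Least[of m "\<lambda>n. real j < \<Phi> (Suc n)"] unfolding B_def by auto
    then show ?thesis using Suc by simp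
  qed (simp add: \<Phi>0)
  have B_le: "B j \<le> n \<longleftrightarrow> real j < \<Phi> (Suc n)" for j n
  proof
    assume "B j \<le> n"
    then show "real j < \<Phi> (Suc n)"
      using upper[of j] strict_mono_less_eq[OF smono, of "Suc (B j)" "Suc n"] by simp
  qed (simp add: B_def Least_le)
  have \<Phi>_nonneg: "0 \<le> \<Phi> n" for n
    using strict_mono_less_eq[OF smono, of 0 n] \<Phi>0 by simp
  have fl: "real (nat \<lfloor>\<Phi> n\<rfloor>) \<le> \<Phi> n" "\<Phi> n < real (Suc (nat \<lfloor>\<Phi> n\<rfloor>))" for n
    using \<Phi>_nonneg[of n] by linarith+
  show ?thesis
  proof
    show "B 0 = 0" using B_le[of 0 0] step(1)[of 0] \<Phi>0 by simp
    show "mono B"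
    proof (rule monoI)
      fix i j :: nat assume "i \<le> j"
      then show "B i \<le> B j" unfolding B_le using upper[of j] by simp
    qed
    show "real j - 1 < \<Phi> (B j)" for j using upper[of j] step(2)[of "B j"] by simp
    show "B (nat \<lfloor>\<Phi> n\<rfloor>) \<le> n" for n
      unfolding B_le using fl(1)[of n] step(1)[of n] by simp
    show "n \<le> B (Suc (nat \<lfloor>\<Phi> n\<rfloor>))" for n
    proof (rule ccontr)
      assume "\<not> n \<le> B (Suc (nat \<lfloor>\<Phi> n\<rfloor>))"
      then have "\<Phi> (Suc (B (Suc (nat \<lfloor>\<Phi> n\<rfloor>)))) \<le> \<Phi> n"
        by (simp add: strict_mono_less_eq[OF smono])
      then show False using upper[of "Suc (nat \<lfloor>\<Phi> n\<rfloor>)"] fl(2)[of n] by simp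
    qed
  qed (rule lower)
qed

lemma filterlim_sum_at_top_of_not_summable:
  fixes p :: "nat \<Rightarrow> real"
  assumes p: "\<And>k. 0 \<le> p k" and "\<not> summable p"
  shows "filterlim (\<lambda>N. \<Sum>k=1..N. p k) at_top sequentially"
  unfolding filterlim_at_top
proof (rule ccontr)
  have eq: "(\<Sum>k=1..N. p k) = (\<Sum>k<N. p (Suc k))" for N
    by (rule sum.reindex_bij_witness[of _ Suc "\<lambda>k. k - 1"]) auto
  assume "\<not> (\<forall>Z. eventually (\<lambda>N. Z \<le> (\<Sum>k=1..N. p k)) sequentially)"
  then have "\<exists>Z. \<forall>n. \<exists>m\<ge>n. (\<Sum>k<m. p (Suc k)) < Z"
    unfolding eq eventually_sequentially by (simp add: not_le)
  then obtain Z where Z: "\<And>n. \<exists>m\<ge>n. (\<Sum>k<m. p (Suc k)) < Z"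
    by blast
  have "(\<Sum>k<n. p (Suc k)) \<le> Z" for n
  proof -
    obtain m where "n \<le> m" "(\<Sum>k<m. p (Suc k)) < Z" using Z by blast
    moreover from \<open>n \<le> m\<close> have "(\<Sum>k<n. p (Suc k)) \<le> (\<Sum>k<m. p (Suc k))"
      using p by (intro sum_mono2) auto
    ultimately show ?thesis by simp
  qed
  then have "summable (\<lambda>k. p (Suc k))"
    using p by (intro summableI_nonneg_bounded) auto
  then show False using assms(2) by (simp add: summable_Suc_iff)
qed

section \<open>Second moments and counting for quasi-independent events\<close>

context prob_space
begin

definition excess :: "(nat \<Rightarrow> 'a set) \<Rightarrow> nat \<Rightarrow> 'a \<Rightarrow> real" where
  "excess E k x = indicator (E k) x - prob (E k)"

context
  fixes E :: "nat \<Rightarrow> 'a set"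
  assumes E [measurable]: "\<And>n. E n \<in> events"
begin

lemma borel_measurable_excess [measurable]: "excess E k \<in> borel_measurable M"
  unfolding excess_def[abs_def] by measurable

lemma
  shows integrable_excess_mult: "integrable M (\<lambda>x. excess E j x * excess E k x)"
    and expectation_excess_mult:
      "expectation (\<lambda>x. excess E j x * excess E k x) = prob (E j \<inter> E k) - prob (E j) * prob (E k)"
proof -
  have eq: "excess E j x * excess E k x = indicator (E j \<inter> E k) x - prob (E k) * indicator (E j) x -
      prob (E j) * indicator (E k) x + prob (E j) * prob (E k)" for x
    by (simp add: excess_def indicator_inter_arith algebra_simps)
  have int: "integrable M (\<lambda>x. indicator A x :: real)" if "A \<in> events" for A
    using that by (simp add: emeasure_eq_measure)
  show "integrable M (\<lambda>x. excess E j x * excess E k x)"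
    unfolding eq by (intro Bochner_Integration.integrable_add Bochner_Integration.integrable_diff integrable_mult_right int) auto
  show "expectation (\<lambda>x. excess E j x * excess E k x) = prob (E j \<inter> E k) - prob (E j) * prob (E k)"
    unfolding eq using int[of "E j \<inter> E k"] int[of "E j"] int[of "E k"] by (simp add: prob_space)
qed

text \<open>Adding the event b + 1 raises the second moment by its variance, at most its
  probability, and by twice its covariances with earlier events. These are charged to the
  probability of the new event with geometric weights of total at most D, whence 1 + 2 D. Half-open
  blocks adjoin without overlap and never contain the index 0, which the correlation hypothesis
  omits as an earlier time.\<close>

lemma
  assumes D: "0 \<le> D" and corr: "\<And>j k. 1 \<le> j \<Longrightarrow> j < k \<Longrightarrow>
      prob (E j \<inter> E k) \<le> (prob (E j) + D * (1 / 2) ^ (k - j)) * prob (E k)"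
    and ab: "a \<le> b"
  shows integrable_sum_excess_square: "integrable M (\<lambda>x. (\<Sum>k\<in>{a<..b}. excess E k x)\<^sup>2)" (is ?int)
    and expectation_sum_excess_square_le:
      "expectation (\<lambda>x. (\<Sum>k\<in>{a<..b}. excess E k x)\<^sup>2) \<le> (1 + 2 * D) * (\<Sum>k\<in>{a<..b}. prob (E k))" (is ?bound)
proof -
  have "?int \<and> ?bound"
    using ab
  proof (induction b rule: dec_induct)
    case base
    then show ?case by simp
  next
    case (step b)
    define X where "X x = (\<Sum>k\<in>{a<..b}. excess E k x)" for x
    define Y where "Y = excess E (Suc b)"
    have ins: "{a<..Suc b} = insert (Suc b) {a<..b}" using step by auto
    have eq: "(\<Sum>k\<in>{a<..Suc b}. excess E k x)\<^sup>2 = (X x)\<^sup>2 + 2 * (\<Sum>k\<in>{a<..b}. excess E k x * Y x) + Y x * Y x" for x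
      unfolding ins X_def Y_def sum_distrib_right[symmetric] by (simp add: power2_eq_square algebra_simps)
    have int_X: "integrable M (\<lambda>x. (X x)\<^sup>2)" using step unfolding X_def by simp
    have int_XY: "integrable M (\<lambda>x. \<Sum>k\<in>{a<..b}. excess E k x * Y x)"
      unfolding Y_def by (intro Bochner_Integration.integrable_sum integrable_excess_mult)
    have int_Y: "integrable M (\<lambda>x. Y x * Y x)" unfolding Y_def by (rule integrable_excess_mult)
    have "expectation (\<lambda>x. \<Sum>k\<in>{a<..b}. excess E k x * Y x) =
        (\<Sum>k\<in>{a<..b}. prob (E k \<inter> E (Suc b)) - prob (E k) * prob (E (Suc b)))"
      unfolding Y_def by (simp add: integrable_excess_mult expectation_excess_mult)
    also have "\<dots> \<le> (\<Sum>k\<in>{a<..b}. D * prob (E (Suc b)) * (1 / 2) ^ (Suc b - k))"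
    proof (rule sum_mono)
      fix k assume "k \<in> {a<..b}"
      then show "prob (E k \<inter> E (Suc b)) - prob (E k) * prob (E (Suc b)) \<le> D * prob (E (Suc b)) * (1 / 2) ^ (Suc b - k)"
        using corr[of k "Suc b"] by (simp add: algebra_simps)
    qed
    also have "\<dots> = D * prob (E (Suc b)) * (\<Sum>k\<in>{a<..b}. (1 / 2) ^ (Suc b - k))"
      by (simp add: sum_distrib_left)
    also have "(\<Sum>k\<in>{a<..b}. (1 / 2 :: real) ^ (Suc b - k)) \<le> 1"
    proof -
      have "(\<Sum>k\<in>{a<..b}. (1 / 2 :: real) ^ (Suc b - k)) = (\<Sum>i<b - a. (1 / 2) ^ Suc i)"
        by (rule sum.reindex_bij_witness[of _ "\<lambda>i. b - i" "\<lambda>k. b - k"]) (auto simp: Suc_diff_le)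
      also have "\<dots> \<le> (\<Sum>i. (1 / 2) ^ Suc i)"
        by (rule sum_le_suminf) (auto intro!: sums_summable[OF power_half_series])
      also have "\<dots> = 1" using power_half_series by (simp add: sums_iff)
      finally show ?thesis .
    qed
    finally have XY: "expectation (\<lambda>x. \<Sum>k\<in>{a<..b}. excess E k x * Y x) \<le> D * prob (E (Suc b))"
      using D by (simp add: mult_left_mono)
    have YY: "expectation (\<lambda>x. Y x * Y x) \<le> prob (E (Suc b))"
      unfolding Y_def expectation_excess_mult by simp
    have "expectation (\<lambda>x. (\<Sum>k\<in>{a<..Suc b}. excess E k x)\<^sup>2) =
        expectation (\<lambda>x. (X x)\<^sup>2) + 2 * expectation (\<lambda>x. \<Sum>k\<in>{a<..b}. excess E k x * Y x) + expectation (\<lambda>x. Y x * Y x)"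
      unfolding eq using int_X int_XY int_Y by simp
    also have "\<dots> \<le> (1 + 2 * D) * (\<Sum>k\<in>{a<..Suc b}. prob (E k))"
      using step.IH XY YY unfolding X_def ins by (simp add: algebra_simps)
    finally have "expectation (\<lambda>x. (\<Sum>k\<in>{a<..Suc b}. excess E k x)\<^sup>2) \<le> (1 + 2 * D) * (\<Sum>k\<in>{a<..Suc b}. prob (E k))" .
    moreover have "integrable M (\<lambda>x. (\<Sum>k\<in>{a<..Suc b}. excess E k x)\<^sup>2)"
      unfolding eq using int_X int_XY int_Y by (intro Bochner_Integration.integrable_add integrable_mult_right)
    ultimately show ?case by simp
  qed
  then show ?int ?bound by simp_all
qed

lemma AE_count_quasi_independent:
  assumes D: "0 \<le> D" and corr: "\<And>j k. 1 \<le> j \<Longrightarrow> j < k \<Longrightarrow>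
      prob (E j \<inter> E k) \<le> (prob (E j) + D * (1 / 2) ^ (k - j)) * prob (E k)"
    and pos: "\<And>k. 1 \<le> k \<Longrightarrow> 0 < prob (E k)" and \<epsilon>: "0 < \<epsilon>"
  defines "\<Phi> \<equiv> \<lambda>N. \<Sum>k=1..N. prob (E k)"
  shows "AE x in M. (\<lambda>N. real (card {n \<in> {1..N}. x \<in> E n}) - \<Phi> N) \<in>
    O(\<lambda>N. \<Phi> N powr (1 / 2) * max 1 (ln (\<Phi> N)) powr (3 / 2 + \<epsilon>))"
proof -
  let ?g = "\<lambda>N. \<Phi> N powr (1 / 2) * max 1 (ln (\<Phi> N)) powr (3 / 2 + \<epsilon>)"
  define cnt where "cnt N x = real (card {n \<in> {1..N}. x \<in> E n})" for N x
  have \<Phi>_Suc: "\<Phi> (Suc N) = \<Phi> N + prob (E (Suc N))" for N by (simp add: \<Phi>_def)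
  have \<Phi>0: "\<Phi> 0 = 0" by (simp add: \<Phi>_def)
  have step: "\<Phi> N < \<Phi> (Suc N)" "\<Phi> (Suc N) \<le> \<Phi> N + 1" for N
    using pos[of "Suc N"] by (simp_all add: \<Phi>_Suc)
  have smono: "strict_mono \<Phi>" using step(1) by (simp add: strict_mono_Suc_iff)
  have cnt_sum: "cnt N x = (\<Sum>k\<in>{0<..N}. indicator (E k) x)" for N x
  proof -
    have "{n \<in> {1..N}. x \<in> E n} = {0<..N} \<inter> {k. x \<in> E k}" by auto
    then show ?thesis
      by (simp add: cnt_def indicator_def flip: of_bool_def) 
  qed
  have S: "cnt N x - \<Phi> N = (\<Sum>k\<in>{0<..N}. excess E k x)" for N x
  proof -
    have "{1..N} = {0<..N}" by auto
    then show ?thesis unfolding cnt_sum \<Phi>_def excess_def by (simp add: sum_subtractf)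
  qed
  have bigO: "(\<lambda>N. cnt N x - \<Phi> N) \<in> O(?g)"
    if "eventually (\<lambda>N. \<bar>cnt N x - \<Phi> N\<bar> \<le> K * ?g N) sequentially" for K x
  proof (rule bigoI[of _ K])
    have g: "\<bar>?g N\<bar> = ?g N" for N by (rule abs_of_nonneg) simp
    show "eventually (\<lambda>N. norm (cnt N x - \<Phi> N) \<le> K * norm (?g N)) sequentially"
      using that unfolding real_norm_def g .
  qed
  show ?thesis
  proof (cases "summable (\<lambda>k. prob (E k))")
    case True
    have \<Phi>_bound: "\<Phi> N \<le> (\<Sum>k. prob (E k))" for N
      unfolding \<Phi>_def by (rule sum_le_suminf[OF True]) auto
    have "AE x in M. eventually (\<lambda>n. x \<in> space M - E n) sequentially"
      by (rule borel_cantelli_AE1[OF _ _ True]) (auto simp: emeasure_eq_measure)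
    then show ?thesis
    proof eventually_elim
      case (elim x)
      then obtain n0 where n0: "\<And>n. n0 \<le> n \<Longrightarrow> x \<notin> E n" by (auto simp: eventually_sequentially)
      have cnt_le: "cnt N x \<le> real n0" for N
      proof -
        have "{n \<in> {1..N}. x \<in> E n} \<subseteq> {..<n0}" using n0 by (auto simp: not_less[symmetric])
        then show ?thesis unfolding cnt_def using card_mono[of "{..<n0}"] by fastforce
      qed
      \<comment> \<open>The count and \<open>\<Phi>\<close> are both bounded here, and for N >= 1
        the comparison function is at least \<open>\<Phi> 1 powr (1 / 2)\<close>, which is
        positive.\<close>
      define K where "K = (real n0 + (\<Sum>k. prob (E k))) / \<Phi> 1 powr (1 / 2)"
      have \<Phi>1: "0 < \<Phi> 1" using pos[of 1] by (simp add: \<Phi>_def)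
      have "\<bar>cnt N x - \<Phi> N\<bar> \<le> K * ?g N" if N: "1 \<le> N" for N
      proof -
        have \<Phi>N: "\<Phi> 1 \<le> \<Phi> N" using N by (simp add: strict_mono_less_eq[OF smono])
        have "\<bar>cnt N x - \<Phi> N\<bar> \<le> real n0 + (\<Sum>k. prob (E k))"
          using cnt_le[of N] \<Phi>_bound[of N] \<Phi>1 \<Phi>N by (simp add: cnt_def abs_le_iff)
        also have "\<dots> = K * (\<Phi> 1 powr (1 / 2) * 1)" using \<Phi>1 by (simp add: K_def)
        also have "\<dots> \<le> K * ?g N"
          using \<Phi>1 \<Phi>N \<epsilon> suminf_nonneg[OF True]
          by (intro mult_left_mono mult_mono powr_mono2 ge_one_powr_ge_zero) (auto simp: K_def)
        finally show ?thesis .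
      qed
      then have "eventually (\<lambda>N. \<bar>cnt N x - \<Phi> N\<bar> \<le> K * ?g N) sequentially"
        by (rule eventually_sequentiallyI)
      from bigO[OF this] show ?case by (simp only: cnt_def)
    qed
  next
    case False
    have lim: "filterlim \<Phi> at_top sequentially"
      unfolding \<Phi>_def by (rule filterlim_sum_at_top_of_not_summable[OF _ False]) simp
    obtain B where B0: "B 0 = 0" and "mono B" and B: "\<And>j. \<Phi> (B j) \<le> real j" "\<And>j. real j - 1 < \<Phi> (B j)"
      "\<And>n. B (nat \<lfloor>\<Phi> n\<rfloor>) \<le> n" "\<And>n. n \<le> B (Suc (nat \<lfloor>\<Phi> n\<rfloor>))"
      by (rule unit_blocks[OF \<Phi>0 step lim]) (rule that)
    define f where "f j x = cnt (B j) x - \<Phi> (B j)" for j x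
    have f_diff: "f v x - f u x = (\<Sum>k\<in>{B u<..B v}. excess E k x)" if "u < v" for u v x
    proof -
      have "B u \<le> B v" using \<open>mono B\<close> that by (simp add: monoD)
      then have "{0<..B v} = {0<..B u} \<union> {B u<..B v}" by auto
      then have "(\<Sum>k\<in>{0<..B v}. excess E k x) = (\<Sum>k\<in>{0<..B u}. excess E k x) + (\<Sum>k\<in>{B u<..B v}. excess E k x)"
        by (simp add: sum.union_disjoint ivl_disj_int)
      then show ?thesis by (simp add: f_def S)
    qed
    have "AE x in M. \<exists>K\<ge>0. \<forall>j. \<bar>f j x\<bar> \<le> K * sqrt (real (Suc j)) * (ln (real (Suc j)) + 1) powr (3 / 2 + \<epsilon>)"
    \<comment> \<open>The extra factor 2 is due to rounding at the block ends: the mean between B u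
      and B v is at most v - u + 1, hence at most 2 (v - u).\<close>
    proof (rule AE_bound_of_increment_variance[where C = "2 * (1 + 2 * D)"])
      show "f 0 x = 0" for x by (simp add: f_def B0 cnt_def \<Phi>_def)
      show "f j \<in> borel_measurable M" for j
        unfolding f_def[abs_def] S by measurable
      fix u v :: nat assume uv: "u < v"
      have Buv: "B u \<le> B v" using \<open>mono B\<close> uv by (simp add: monoD)
      show "integrable M (\<lambda>x. (f v x - f u x)\<^sup>2)"
        unfolding f_diff[OF uv] by (rule integrable_sum_excess_square[OF D corr Buv])
      have "expectation (\<lambda>x. (f v x - f u x)\<^sup>2) \<le> (1 + 2 * D) * (\<Sum>k\<in>{B u<..B v}. prob (E k))"
        unfolding f_diff[OF uv] by (rule expectation_sum_excess_square_le[OF D corr Buv])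
      also have "(\<Sum>k\<in>{B u<..B v}. prob (E k)) = \<Phi> (B v) - \<Phi> (B u)"
      proof -
        have eq: "{1..B v} = {1..B u} \<union> {B u<..B v}" using Buv by auto
        show ?thesis unfolding \<Phi>_def eq by (subst sum.union_disjoint) auto
      qed
      also have "(1 + 2 * D) * (\<Phi> (B v) - \<Phi> (B u)) \<le> (1 + 2 * D) * (2 * real (v - u))"
      proof (intro mult_left_mono)
        have "real v - real u \<ge> 1" using uv by linarith
        then show "\<Phi> (B v) - \<Phi> (B u) \<le> 2 * real (v - u)"
          using B(1)[of v] B(2)[of u] uv by (simp add: of_nat_diff)
      qed (use D in simp)
      finally show "expectation (\<lambda>x. (f v x - f u x)\<^sup>2) \<le> 2 * (1 + 2 * D) * real (v - u)"
        by (simp only: mult.assoc mult.left_commute[of 2])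
    qed (use D \<epsilon> in auto)
    then show ?thesis
    proof eventually_elim
      case (elim x)
      then obtain K where K: "0 \<le> K"
        "\<And>j. \<bar>f j x\<bar> \<le> K * sqrt (real (Suc j)) * (ln (real (Suc j)) + 1) powr (3 / 2 + \<epsilon>)" by blast
      define p where "p = 3 / 2 + \<epsilon>"
      \<comment> \<open>Two block ends each contribute K sqrt 3 \<open>4 powr p\<close>, where 3
        comes from J + 2 <= 3 \<open>\<Phi> N\<close> and 4 from ln 3 + 1 <= 3. The summand 2 is the
        rounding error of the sandwich below.\<close>
      define K' where "K' = 2 * K * sqrt 3 * 4 powr p + 2"
      have "\<bar>cnt N x - \<Phi> N\<bar> \<le> K' * ?g N" if \<Phi>1: "1 \<le> \<Phi> N" for N
      proof -
        define J where "J = nat \<lfloor>\<Phi> N\<rfloor>"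
        have J: "real J \<le> \<Phi> N" "\<Phi> N < real J + 1" using \<Phi>1 by (simp_all add: J_def)
        define l where "l = max 1 (ln (\<Phi> N))"
        have l: "1 \<le> l" by (simp add: l_def)
        have f_le: "\<bar>f j x\<bar> \<le> K * (sqrt 3 * sqrt (\<Phi> N)) * (4 powr p * l powr p)" if j: "j \<le> Suc J" for j
        proof -
          have j3: "real (Suc j) \<le> 3 * \<Phi> N" using j J \<Phi>1 by simp
          have "ln (real (Suc j)) \<le> ln (3 * \<Phi> N)" using j3 \<Phi>1 by (subst ln_le_cancel_iff) auto
          also have "\<dots> = ln 3 + ln (\<Phi> N)" using \<Phi>1 by (simp add: ln_mult)
          also have "\<dots> \<le> 2 + ln (\<Phi> N)" using ln_le_minus_one[of "3 :: real"] by simp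
          also have "\<dots> + 1 \<le> 4 * l" by (simp add: l_def)
          finally have "ln (real (Suc j)) + 1 \<le> 4 * l" by simp
          then have "(ln (real (Suc j)) + 1) powr p \<le> (4 * l) powr p"
            using \<epsilon> by (intro powr_mono2) (auto simp: p_def)
          also have "\<dots> = 4 powr p * l powr p" using l by (simp add: powr_mult)
          finally have pw: "(ln (real (Suc j)) + 1) powr p \<le> 4 powr p * l powr p" .
          have "sqrt (real (Suc j)) \<le> sqrt (3 * \<Phi> N)" using j3 by (rule real_sqrt_le_mono)
          then have "sqrt (real (Suc j)) \<le> sqrt 3 * sqrt (\<Phi> N)" by (simp add: real_sqrt_mult)
          then have "K * sqrt (real (Suc j)) * (ln (real (Suc j)) + 1) powr p \<le>
              K * (sqrt 3 * sqrt (\<Phi> N)) * (4 powr p * l powr p)"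
            using K(1) pw \<Phi>1 by (intro mult_mono mult_left_mono) auto
          then show ?thesis using K(2)[of j] by (simp add: p_def)
        qed
        have cnt_mono: "cnt m x \<le> cnt n x" if "m \<le> n" for m n
          unfolding cnt_def using that by (intro of_nat_mono card_mono) auto
        \<comment> \<open>N lies between B J and B (J + 1). Passing to the upper end costs at most
          1, to the lower end at most 2, because \<open>\<Phi> (B J)\<close> may be as low as J -
          1.\<close>
        have "cnt N x - \<Phi> N \<le> f (Suc J) x + 1"
          using cnt_mono[OF B(4)[of N, folded J_def]] B(1)[of "Suc J"] J unfolding f_def by simp
        moreover have "f J x - 2 \<le> cnt N x - \<Phi> N"
          using cnt_mono[OF B(3)[of N, folded J_def]] B(2)[of J] J unfolding f_def by simp
        ultimately have "\<bar>cnt N x - \<Phi> N\<bar> \<le> \<bar>f J x\<bar> + \<bar>f (Suc J) x\<bar> + 2" by linarith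
        also have "\<dots> \<le> 2 * (K * (sqrt 3 * sqrt (\<Phi> N)) * (4 powr p * l powr p)) + 2 * (sqrt (\<Phi> N) * l powr p)"
        proof -
          have "1 * 1 \<le> sqrt (\<Phi> N) * l powr p"
            using \<Phi>1 l \<epsilon> by (intro mult_mono ge_one_powr_ge_zero) (auto simp: p_def)
          then show ?thesis using f_le[of J] f_le[of "Suc J"] by simp
        qed
        also have "\<dots> = K' * ?g N"
          using \<Phi>1 by (simp add: K'_def l_def p_def powr_half_sqrt algebra_simps)
        finally show ?thesis .
      qed
      moreover have "eventually (\<lambda>N. 1 \<le> \<Phi> N) sequentially"
        using lim by (simp add: filterlim_at_top)
      ultimately have "eventually (\<lambda>N. \<bar>cnt N x - \<Phi> N\<bar> \<le> K' * ?g N) sequentially"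
        by (rule eventually_mono[rotated])
      from bigO[OF this] show ?case by (simp only: cnt_def)
    qed
  qed
qed

text \<open>The counting error is of smaller order than the divergent main term, so a bounded count
  would make \<open>\<Phi>\<close> negligible against itself. Any positive exponent loss serves; 1
  is taken.\<close>

lemma AE_infinite_quasi_independent:
  assumes D: "0 \<le> D" and corr: "\<And>j k. 1 \<le> j \<Longrightarrow> j < k \<Longrightarrow>
      prob (E j \<inter> E k) \<le> (prob (E j) + D * (1 / 2) ^ (k - j)) * prob (E k)"
    and pos: "\<And>k. 1 \<le> k \<Longrightarrow> 0 < prob (E k)" and div: "\<not> summable (\<lambda>k. prob (E k))"
  shows "AE x in M. infinite {n. 1 \<le> n \<and> x \<in> E n}"
proof -
  define \<Phi> where "\<Phi> N = (\<Sum>k=1..N. prob (E k))" for N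
  have lim: "filterlim \<Phi> at_top sequentially"
    unfolding \<Phi>_def by (rule filterlim_sum_at_top_of_not_summable[OF _ div]) simp
  have "(\<lambda>y::real. y powr (1 / 2) * max 1 (ln y) powr (3 / 2 + 1)) \<in> o(\<lambda>y. y)"
    by real_asymp
  from landau_o.small.compose[OF this lim]
  have small: "(\<lambda>N. \<Phi> N powr (1 / 2) * max 1 (ln (\<Phi> N)) powr (3 / 2 + 1)) \<in> o(\<Phi>)" .
  have "AE x in M. (\<lambda>N. real (card {n \<in> {1..N}. x \<in> E n}) - \<Phi> N) \<in>
      O(\<lambda>N. \<Phi> N powr (1 / 2) * max 1 (ln (\<Phi> N)) powr (3 / 2 + 1))"
    unfolding \<Phi>_def by (rule AE_count_quasi_independent[OF D corr pos zero_less_one])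
  then show ?thesis
  proof eventually_elim
    case (elim x)
    show ?case
    proof
      assume fin: "finite {n. 1 \<le> n \<and> x \<in> E n}"
      have "(\<lambda>N. real (card {n \<in> {1..N}. x \<in> E n})) \<in> O(\<lambda>_. 1)"
        using fin by (intro bigoI[of _ "real (card {n. 1 \<le> n \<and> x \<in> E n})"] always_eventually allI)
          (auto intro!: card_mono)
      also have "(\<lambda>_. 1) \<in> o(\<Phi>)"
        by (rule landau_o.small.compose[OF _ lim, of "\<lambda>_. 1" "\<lambda>y. y"]) real_asymp
      finally have 1: "(\<lambda>N. real (card {n \<in> {1..N}. x \<in> E n})) \<in> o(\<Phi>)" .
      from sum_in_smallo(2)[OF 1 landau_o.big_small_trans[OF elim small]]
      have "\<Phi> \<in> o(\<Phi>)" by simp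
      then have "eventually (\<lambda>N. \<Phi> N = 0) sequentially"
        by (simp add: landau_o.small_refl_iff)
      moreover have "eventually (\<lambda>N. 0 < \<Phi> N) sequentially"
        using lim by (simp add: filterlim_at_top_dense)
      ultimately have "eventually (\<lambda>N. False) sequentially"
        by eventually_elim simp
      then show False by simp
    qed
  qed
qed

end

end

section \<open>Transfer from the product space to the torus\<close>

lemma borel_measurable_vec_nth [measurable]: "(\<lambda>x. x $ i) \<in> borel_measurable (borel :: (real ^ 'n) measure)"
  by (intro borel_measurable_continuous_onI continuous_intros)

lemma measurable_vec_lambda_PiM [measurable]:
  "vec_lambda \<in> borel_measurable (PiM UNIV (\<lambda>_. lborel) :: ('n::finite \<Rightarrow> real) measure)"
  unfolding borel_measurable_euclidean_space[of vec_lambda]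
  by (auto simp: Basis_vec_def inner_axis)

text \<open>Lebesgue measure is determined by its values on boxes. This links vectors, in which the
  theorem is stated, with function spaces, where independence and integration one coordinate at a
  time are available.\<close>

lemma lborel_eq_distr_vec_lambda:
  "(lborel :: (real ^ 'n) measure) = distr (PiM UNIV (\<lambda>_. lborel)) borel vec_lambda"
proof (rule lborel_eqI)
  interpret L: product_sigma_finite "\<lambda>_ :: 'n. lborel :: real measure"
    by unfold_locales
  fix l u :: "real ^ 'n" assume lu: "\<And>b. b \<in> Basis \<Longrightarrow> l \<bullet> b \<le> u \<bullet> b"
  have le: "l $ i \<le> u $ i" for i
    using lu[of "axis i 1"] by (simp add: inner_axis axis_in_Basis_iff)
  have "emeasure (distr (PiM UNIV (\<lambda>_. lborel)) borel vec_lambda) (box l u) =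
      emeasure (PiM UNIV (\<lambda>_. lborel)) (\<Pi>\<^sub>E i\<in>UNIV. {l $ i<..<u $ i})"
    by (subst emeasure_distr) (auto simp: space_PiM PiE_iff mem_box_cart intro!: arg_cong2[where f = emeasure])
  also have "\<dots> = (\<Prod>i\<in>UNIV. ennreal (u $ i - l $ i))"
    by (subst L.emeasure_PiM) (auto simp: le)
  also have "\<dots> = ennreal (\<Prod>i\<in>UNIV. u $ i - l $ i)"
    using le by (intro prod_ennreal) simp
  also have "(\<Prod>i\<in>UNIV. u $ i - l $ i) = (\<Prod>b\<in>range (\<lambda>i. axis i 1). (u - l) \<bullet> b)"
    by (subst prod.reindex) (auto simp: inner_axis inj_on_def axis_eq_axis)
  also have "range (\<lambda>i. axis i 1) = (Basis :: (real ^ 'n) set)"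
    by (auto simp: Basis_vec_def)
  finally show "emeasure (distr (PiM UNIV (\<lambda>_. lborel)) borel vec_lambda) (box l u) = ennreal (\<Prod>b\<in>Basis. (u - l) \<bullet> b)" .
qed simp

lemma sets_torus [measurable]: "torus \<in> sets (borel :: (real ^ 'n) measure)"
  unfolding torus_def by measurable

lemma measurable_vec_nth_cube [measurable]:
  "(\<lambda>x i. x $ i) \<in> measurable borel (cube UNIV :: ('n::finite \<Rightarrow> real) measure)"
proof -
  have "(\<lambda>x. \<lambda>i\<in>UNIV. x $ i) \<in> measurable borel (cube UNIV :: ('n \<Rightarrow> real) measure)"
    by (rule measurable_restrict) measurable
  then show ?thesis by (simp only: restrict_UNIV)
qed

text \<open>Rectangles suffice: intersecting with \<open>torus\<close> cuts every factor down to
  [0,1), which is what \<open>unif\<close> does on the line.\<close>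

lemma distr_torus_cube:
  "distr (restrict_space lborel (torus :: (real ^ 'n) set)) (cube UNIV) (\<lambda>x i. x $ i) = cube UNIV"
proof (rule cube.PiM_eqI)
  interpret L: product_sigma_finite "\<lambda>_ :: 'n. lborel :: real measure"
    by unfold_locales
  fix A :: "'n \<Rightarrow> real set" assume "\<And>i. i \<in> UNIV \<Longrightarrow> A i \<in> sets unif"
  then have A [measurable]: "A i \<in> sets borel" for i by simp
  have [measurable]: "(\<lambda>x i. x $ i) \<in> measurable (restrict_space lborel (torus :: (real ^ 'n) set)) (cube UNIV)"
    by (rule measurable_restrict_space1) simp
  define B where "B = {x :: real ^ 'n. x \<in> torus \<and> (\<forall>i. x $ i \<in> A i)}"
  have [measurable]: "B \<in> sets borel" unfolding B_def by measurable
  have "emeasure (distr (restrict_space lborel (torus :: (real ^ 'n) set)) (cube UNIV) (\<lambda>x i. x $ i)) (Pi\<^sub>E UNIV A) =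
      emeasure (restrict_space lborel (torus :: (real ^ 'n) set)) B"
    by (subst emeasure_distr)
       (auto simp: B_def space_restrict_space PiE_iff intro!: sets_PiM_I_finite arg_cong2[where f = emeasure])
  also have "\<dots> = emeasure lborel B"
    by (rule emeasure_restrict_space) (auto simp: B_def)
  also have "\<dots> = emeasure (PiM UNIV (\<lambda>_. lborel)) (\<Pi>\<^sub>E i\<in>UNIV. {0..<1} \<inter> A i)"
    unfolding lborel_eq_distr_vec_lambda
    by (subst emeasure_distr) (auto simp: B_def torus_def space_PiM PiE_iff intro!: arg_cong2[where f = emeasure])
  also have "\<dots> = (\<Prod>i\<in>UNIV. emeasure unif (A i))"
    by (subst L.emeasure_PiM) (auto simp: emeasure_unif)
  finally show "emeasure (distr (restrict_space lborel (torus :: (real ^ 'n) set)) (cube UNIV) (\<lambda>x i. x $ i)) (Pi\<^sub>E UNIV A) =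
      (\<Prod>i\<in>UNIV. emeasure unif (A i))" .
qed auto

lemma AE_torus_of_cube:
  assumes "AE x in cube (UNIV :: 'n::finite set). P x"
  shows "AE x in lebesgue. x \<in> torus \<longrightarrow> P (\<lambda>i. (x :: real ^ 'n) $ i)"
proof -
  have "(\<lambda>x i. x $ i) \<in> measurable (restrict_space lborel (torus :: (real ^ 'n) set)) (cube UNIV)"
    by (rule measurable_restrict_space1) simp
  from AE_distrD[OF this, of P] assms
  have "AE x in restrict_space lborel (torus :: (real ^ 'n) set). P (\<lambda>i. x $ i)"
    unfolding distr_torus_cube by simp
  then show ?thesis
    by (subst (asm) AE_restrict_space_iff) (auto intro: AE_completion)
qed

lemma emeasure_torus: "emeasure lebesgue (torus :: (real ^ 'n) set) = 1"
proof -
  have "(\<lambda>x i. x $ i) \<in> measurable (restrict_space lborel (torus :: (real ^ 'n) set)) (cube UNIV)"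
    by (rule measurable_restrict_space1) simp
  then have "emeasure (distr (restrict_space lborel (torus :: (real ^ 'n) set)) (cube UNIV) (\<lambda>x i. x $ i))
      (space (cube UNIV)) = emeasure (restrict_space lborel (torus :: (real ^ 'n) set)) torus"
    by (subst emeasure_distr[OF _ sets.top])
       (auto simp: space_restrict_space space_PiM intro!: arg_cong2[where f = emeasure])
  then show ?thesis
    unfolding distr_torus_cube
    by (simp add: emeasure_restrict_space prob_space.emeasure_space_1[OF prob_space_cube])
qed

lemma sets_W_times: "W_times T \<psi> (a :: real ^ 'd) \<in> sets borel"
proof -
  have [measurable]: "(\<lambda>x :: real ^ 'd. \<Prod>i\<in>UNIV. dist_int (of_int (T $ i $ i) ^ n * x $ i - a $ i)) \<in> borel_measurable borel" for n
    by (rule borel_measurable_prod) measurable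
  show ?thesis
    unfolding W_times_def infinite_nat_iff_unbounded by measurable
qed

section \<open>Zero-one law and counting\<close>

text \<open>With L = ln (1 / (2^d c)) and l = ln (1 / c) one has l = L + d ln 2, so the Erlang sum
  in L and the power of l are comparable up to constants depending on d. The delicate range is L
  near 0; there l is still at least 1/2 and the Erlang sum at least 1, its term with s = 0.\<close>

lemma summable_log_power_iff:
  fixes c :: "nat \<Rightarrow> real"
  assumes d: "d \<ge> 1" and c: "\<And>n. 0 < c n" "\<And>n. c n < 1 / 2 ^ d"
  shows "summable (\<lambda>n. c n * ln (1 / c n) ^ (d - 1)) \<longleftrightarrow>
    summable (\<lambda>n. 2 ^ d * c n * (\<Sum>s<d. 1 / fact s * ln (1 / (2 ^ d * c n)) ^ s))"
proof -
  define q where "q n = c n * ln (1 / c n) ^ (d - 1)" for n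
  define p where "p n = 2 ^ d * c n * (\<Sum>s<d. 1 / fact s * ln (1 / (2 ^ d * c n)) ^ s)" for n
  have L: "0 \<le> ln (1 / (2 ^ d * c n))" "ln (1 / c n) = ln (1 / (2 ^ d * c n)) + real d * ln 2" for n
  proof -
    have "2 ^ d * c n < 1" using c(2)[of n] by (simp add: field_simps)
    then show "0 \<le> ln (1 / (2 ^ d * c n))" using c(1)[of n] by (simp add: ln_div)
    show "ln (1 / c n) = ln (1 / (2 ^ d * c n)) + real d * ln 2"
      using c(1)[of n] by (simp add: ln_div ln_mult ln_realpow)
  qed
  have d_ln2: "1 / 2 \<le> real d * ln 2" "real d * ln 2 \<le> real d"
  proof -
    have "1 * (1 / 2) \<le> real d * ln 2"
      using d ln2_ge_two_thirds by (intro mult_mono) auto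
    then show "1 / 2 \<le> real d * ln 2" by simp
    show "real d * ln 2 \<le> real d" using ln2_le_25_over_36 by (simp add: mult_left_le)
  qed
  have p_nonneg: "0 \<le> p n" and q_nonneg: "0 \<le> q n" for n
    unfolding p_def q_def L(2) using c(1)[of n] L(1)[of n] d_ln2
    by (auto intro!: mult_nonneg_nonneg sum_nonneg zero_le_power)
  have comparison: "summable u" if "summable v" "\<And>n. 0 \<le> u n" "\<And>n. u n \<le> K * v n" for u v :: "nat \<Rightarrow> real" and K
    by (rule summable_comparison_test'[OF summable_mult[OF that(1), of K], of 0]) (use that in auto)
  have p_le: "p n \<le> (2 ^ d * (real d * 2 ^ (d - 1))) * q n" for n
  proof -
    define L where "L = ln (1 / (2 ^ d * c n))"
    define l where "l = ln (1 / c n)"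
    have Ll: "0 \<le> L" "L \<le> 2 * l" "1 \<le> 2 * l"
      unfolding L_def l_def L(2) using L(1)[of n] d_ln2 by auto
    \<comment> \<open>The base 2 l is at least 1, so all exponents can be raised to d - 1; L itself
      may be below 1.\<close>
    have "(\<Sum>s<d. 1 / fact s * L ^ s) \<le> (\<Sum>s<d. 1 * (2 * l) ^ (d - 1))"
    proof (intro sum_mono mult_mono)
      fix s assume "s \<in> {..<d}"
      then have "(2 * l) ^ s \<le> (2 * l) ^ (d - 1)" using Ll by (intro power_increasing) auto
      then show "L ^ s \<le> (2 * l) ^ (d - 1)"
        using power_mono[of L "2 * l" s] Ll by linarith
    qed (use Ll in \<open>auto simp: divide_le_eq_1\<close>)
    also have "\<dots> = real d * 2 ^ (d - 1) * l ^ (d - 1)" by (simp add: power_mult_distrib)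
    finally have "p n \<le> 2 ^ d * c n * (real d * 2 ^ (d - 1) * l ^ (d - 1))"
      unfolding p_def L_def using c(1)[of n] by (intro mult_left_mono) auto
    then show ?thesis by (simp add: q_def l_def ac_simps)
  qed
  have q_le: "q n \<le> (2 ^ (d - 1) * (fact (d - 1) + real d ^ (d - 1))) * p n" for n
  proof -
    define L where "L = ln (1 / (2 ^ d * c n))"
    define l where "l = ln (1 / c n)"
    define \<Sigma> where "\<Sigma> = (\<Sum>s<d. 1 / fact s * L ^ s)"
    have Ll: "0 \<le> L" "0 \<le> l" "l \<le> 2 * max L (real d)"
      unfolding L_def l_def L(2) using L(1)[of n] d_ln2 by auto
    have term_le: "1 / fact s * L ^ s \<le> \<Sigma>" if "s < d" for s
      unfolding \<Sigma>_def using that Ll by (intro member_le_sum) auto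
    \<comment> \<open>Bounding L + d ln 2 by twice a maximum replaces a binomial expansion.\<close>
    have "l ^ (d - 1) \<le> (2 * max L (real d)) ^ (d - 1)"
      using Ll by (intro power_mono) auto
    also have "\<dots> \<le> 2 ^ (d - 1) * (L ^ (d - 1) + real d ^ (d - 1))"
      using Ll by (auto simp: power_mult_distrib max_def)
    also have "\<dots> \<le> 2 ^ (d - 1) * (fact (d - 1) * \<Sigma> + real d ^ (d - 1) * \<Sigma>)"
    proof (intro mult_left_mono add_mono)
      have "1 / fact (d - 1) * L ^ (d - 1) \<le> \<Sigma>" using d by (intro term_le) simp
      then show "L ^ (d - 1) \<le> fact (d - 1) * \<Sigma>" by (simp add: field_simps)
      have "1 \<le> \<Sigma>" using term_le[of 0] d by simp
      then show "real d ^ (d - 1) \<le> real d ^ (d - 1) * \<Sigma>" by (simp add: mult_le_cancel_left1)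
    qed simp
    finally have "q n \<le> c n * (2 ^ (d - 1) * (fact (d - 1) + real d ^ (d - 1)) * \<Sigma>)"
      unfolding q_def l_def using c(1)[of n] by (intro mult_left_mono) (auto simp: algebra_simps)
    also have "\<dots> \<le> 2 ^ d * (c n * (2 ^ (d - 1) * (fact (d - 1) + real d ^ (d - 1)) * \<Sigma>))"
    proof -
      have "0 \<le> c n * (2 ^ (d - 1) * (fact (d - 1) + real d ^ (d - 1)) * \<Sigma>)"
        using c(1)[of n] term_le[of 0] d by simp
      from mult_right_mono[OF one_le_power[of "2 :: real" d] this] show ?thesis by simp
    qed
    finally show ?thesis by (simp add: p_def L_def \<Sigma>_def ac_simps)
  qed
  have "summable q \<longleftrightarrow> summable p"
  proof
    assume "summable q"
    then show "summable p" by (rule comparison[OF _ p_nonneg p_le])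
  next
    assume "summable p"
    then show "summable q" by (rule comparison[OF _ q_nonneg q_le])
  qed
  then show ?thesis by (simp only: p_def[abs_def] q_def[abs_def])
qed

theorem corollary3:
  fixes t :: "'d::finite \<Rightarrow> int" and \<psi> :: "real \<Rightarrow> real" and a :: "real ^ 'd"
  assumes "\<And>i. t i \<ge> 2"
    and "\<And>x. x > 0 \<Longrightarrow> \<psi> x > 0"
    and "\<And>x. x > 0 \<Longrightarrow> \<psi> x < 1 / 2 ^ CARD('d)"
    and "a \<in> torus"
  shows "(\<forall>\<epsilon>::real. \<epsilon> > 0 \<longrightarrow>
           (AE x in lebesgue_on (torus :: (real ^ 'd) set).
             (\<lambda>N. real (card {n \<in> {1..N}.
                     (\<Prod>i\<in>UNIV. dist_int (of_int (t i) ^ n * x $ i - a $ i)) \<le> \<psi> (real n)})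
                   - Phi CARD('d) \<psi> N)
             \<in> O(\<lambda>N. Phi CARD('d) \<psi> N powr (1 / 2) *
                     max 1 (ln (Phi CARD('d) \<psi> N)) powr (3 / 2 + \<epsilon>))))
       \<and> W_times (diag_mat t) \<psi> a \<in> sets lebesgue
       \<and> (summable (\<lambda>n. \<psi> (real (Suc n)) * ln (1 / \<psi> (real (Suc n))) ^ (CARD('d) - 1))
            \<longrightarrow> emeasure lebesgue (W_times (diag_mat t) \<psi> a) = 0)
       \<and> (\<not> summable (\<lambda>n. \<psi> (real (Suc n)) * ln (1 / \<psi> (real (Suc n))) ^ (CARD('d) - 1))
            \<longrightarrow> emeasure lebesgue (W_times (diag_mat t) \<psi> a) = 1)"
proof -
  interpret P: prob_space "cube (UNIV :: 'd set)" by (rule prob_space_cube)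
  define E where "E n = hits UNIV t (\<lambda>i. a $ i) (\<psi> (real n)) n" for n
  define W where "W = W_times (diag_mat t) \<psi> a"
  define D where "D = 6 * real CARD('d)"
  have E_iff: "x \<in> E n \<longleftrightarrow> (\<Prod>i\<in>UNIV. dist_int (of_int (t i) ^ n * x i - a $ i)) \<le> \<psi> (real n)" for x n
    by (simp add: E_def hits_def space_PiM)
  have E_events [measurable]: "E n \<in> P.events" for n
    by (simp add: E_def sets_hits)
  have prob_E: "P.prob (E n) = 2 ^ CARD('d) * \<psi> (real n) *
      (\<Sum>s<CARD('d). 1 / fact s * ln (1 / (2 ^ CARD('d) * \<psi> (real n))) ^ s)" if n: "1 \<le> n" for n
    unfolding E_def using assms(1) assms(2,3)[of "real n"] n
    by (intro measure_hits) (auto simp: field_simps intro: order_trans[of 1 2])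
  have D: "0 \<le> D" by (simp add: D_def)
  have corr: "P.prob (E j \<inter> E k) \<le> (P.prob (E j) + D * (1 / 2) ^ (k - j)) * P.prob (E k)" if "1 \<le> j" "j < k" for j k
    unfolding E_def D_def using assms(1,4) that by (intro measure_hits_Int_le) (auto simp: torus_def)
  have pos: "0 < P.prob (E n)" if n: "1 \<le> n" for n
  proof -
    define L where "L = ln (1 / (2 ^ CARD('d) * \<psi> (real n)))"
    have \<psi>: "0 < \<psi> (real n)" "2 ^ CARD('d) * \<psi> (real n) < 1"
      using assms(2,3)[of "real n"] n by (auto simp: field_simps)
    then have "0 \<le> L" by (simp add: L_def ln_div)
    then have "1 / fact 0 * L ^ 0 \<le> (\<Sum>s<CARD('d). 1 / fact s * L ^ s)"
      by (intro member_le_sum) auto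
    then show ?thesis using \<psi> by (simp add: prob_E[OF n] L_def)
  qed
  have Phi_eq: "Phi CARD('d) \<psi> N = (\<Sum>n=1..N. P.prob (E n))" for N
    unfolding Phi_def by (intro sum.cong refl) (simp add: prob_E)
  \<comment> \<open>The event with index 0 involves \<open>\<psi> 0\<close>, about which nothing is
    assumed; dropping one term does not affect summability.\<close>
  have summable_iff: "summable (\<lambda>n. \<psi> (real (Suc n)) * ln (1 / \<psi> (real (Suc n))) ^ (CARD('d) - 1)) \<longleftrightarrow>
      summable (\<lambda>n. P.prob (E n))"
  proof -
    have "summable (\<lambda>n. \<psi> (real (Suc n)) * ln (1 / \<psi> (real (Suc n))) ^ (CARD('d) - 1)) \<longleftrightarrow>
        summable (\<lambda>n. P.prob (E (Suc n)))"
      using summable_log_power_iff[of "CARD('d)" "\<lambda>n. \<psi> (real (Suc n))"] assms(2,3)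
      by (simp add: prob_E Suc_le_eq del: of_nat_Suc)
    then show ?thesis
      using summable_Suc_iff[of "\<lambda>n. P.prob (E n)"] by (rule trans)
  qed
  have W_iff: "x \<in> W \<longleftrightarrow> x \<in> torus \<and> infinite {n. 1 \<le> n \<and> (\<lambda>i. x $ i) \<in> E n}" for x
    by (simp add: W_def W_times_def E_iff diag_mat_def)
  have sets_W [measurable]: "W \<in> sets lebesgue"
    unfolding W_def by (intro sets_completionI_sets) (simp add: sets_W_times)
  have "AE x in lebesgue_on (torus :: (real ^ 'd) set).
      (\<lambda>N. real (card {n \<in> {1..N}. (\<Prod>i\<in>UNIV. dist_int (of_int (t i) ^ n * x $ i - a $ i)) \<le> \<psi> (real n)})
        - Phi CARD('d) \<psi> N) \<in>
      O(\<lambda>N. Phi CARD('d) \<psi> N powr (1 / 2) * max 1 (ln (Phi CARD('d) \<psi> N)) powr (3 / 2 + \<epsilon>))"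
    if "0 < \<epsilon>" for \<epsilon>
    using AE_torus_of_cube[OF P.AE_count_quasi_independent[OF E_events D corr pos that]]
    by (subst AE_restrict_space_iff) (simp_all add: Phi_eq E_iff)
  moreover have "emeasure lebesgue W = 0" if "summable (\<lambda>n. P.prob (E n))"
  proof -
    have "AE x in cube UNIV. eventually (\<lambda>n. x \<in> space (cube UNIV) - E n) sequentially"
      by (rule borel_cantelli_AE1[OF _ _ that]) (auto simp: P.emeasure_eq_measure)
    then have "AE x in cube UNIV. finite {n. 1 \<le> n \<and> x \<in> E n}"
    proof eventually_elim
      case (elim x)
      then obtain m where "\<And>n. m \<le> n \<Longrightarrow> x \<notin> E n" by (auto simp: eventually_sequentially)
      then have "{n. 1 \<le> n \<and> x \<in> E n} \<subseteq> {..<m}" by (auto simp: not_le[symmetric])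
      then show ?case by (rule finite_subset) simp
    qed
    from AE_torus_of_cube[OF this] have "AE x in lebesgue. x \<notin> W"
      by (rule AE_mp) (auto simp: W_iff)
    then show ?thesis
      using AE_iff_measurable[of W lebesgue "\<lambda>x. x \<notin> W"] sets_W by simp
  qed
  moreover have "emeasure lebesgue W = 1" if "\<not> summable (\<lambda>n. P.prob (E n))"
  proof -
    have "AE x in lebesgue. x \<in> W \<longleftrightarrow> x \<in> torus"
      by (rule AE_mp[OF AE_torus_of_cube[OF P.AE_infinite_quasi_independent[OF E_events D corr pos that]]])
         (auto simp: W_iff)
    then have "emeasure lebesgue W = emeasure lebesgue (torus :: (real ^ 'd) set)"
      using sets_torus by (intro emeasure_eq_AE) auto
    then show ?thesis by (simp only: emeasure_torus)
  qed
  ultimately show ?thesis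
    using sets_W unfolding summable_iff W_def[symmetric] by blast
qed

end
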